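(* Let $\ell,n,r$ be positive integers and $q$ a prime power, and let $\varepsilon$ be a square root of $q$. Let $I_r\colon\mathscr A_\ell\otimes_{\mathbb Z}S_{\mathbb F_q}(n,\ell r)\to\mathscr A_\ell\otimes_{\mathbb Z}S_{\mathbb F_{q^\ell}}(n,r)$ be the $\mathscr A_\ell$-linear map induced by the restriction map $\iota^*$. Then $I_r$ is an algebra homomorphism.
   Context: For a finite field $\mathbf k$ and a finite-dimensional $\mathbf k$-vector space $V$ of dimension $r$, let $\mathcal F^n_V$ be the set of $n$-step partial flags $(0=F_0\subseteq F_1\subseteq\dots\subseteq F_n=V)$ of $\mathbf k$-subspaces of $V$. $S_{\mathbf k}(n,r)$ is the ring of $\mathbb Z$-valued functions on $\mathcal F^n_V\times\mathcal F^n_V$ that are invariant under the diagonal action of $GL(V)$, with convolution product $(f\cdot g)(F,F'')=\sum_{F'\in\mathcal F^n_V}f(F,F')g(F',F'')$. Let $V$ be an $r$-dimensional $\mathbb F_{q^\ell}$-vector space and let $W$ be $V$ regarded as an $\mathbb F_q$-vector space (of dimension $\ell r$). Build $S_{\mathbb F_{q^\ell}}(n,r)$ from $V$ and $S_{\mathbb F_q}(n,\ell r)$ from $W$. Every flag of $\mathbb F_{q^\ell}$-subspaces of $V$ is a flag of $\mathbb F_q$-subspaces of $W$, giving an inclusion $\iota\colon\mathcal F^n_V\times\mathcal F^n_V\hookrightarrow\mathcal F^n_W\times\mathcal F^n_W$, and $\iota^*\colon S_{\mathbb F_q}(n,\ell r)\to S_{\mathbb F_{q^\ell}}(n,r)$,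 $\iota^*(f)=f\circ\iota$, is restriction of functions. $\mathscr A_\ell=\mathbb Z[\varepsilon,\varepsilon^{-1}]/(\Phi_{2\ell}(\varepsilon))$, where $\mathbb Z[\varepsilon,\varepsilon^{-1}]$ is the subring of $\mathbb C$ generated by the number $\varepsilon$ ($\varepsilon^2=q$) and its inverse, and $\Phi_k$ is the $k$-th cyclotomic polynomial. *)

theory Defs
  imports
    "HOL-Algebra.Algebra"
    "HOL-Algebra.Algebraic_Closure_Type"
    "HOL-Library.Cardinality"
    "HOL-Number_Theory.Prime_Powers"
    "HOL-Computational_Algebra.Polynomial"
    Complex_Main
begin

section \<open>Partial flags and the ring of invariant functions on pairs of flags\<close>

text \<open>A vector space is given by its scalar multiplication on the type of all vectors.
  A flag is the list of its members, so \<^term>\<open>F ! i\<close> is the \<open>i\<close>-th subspace.\<close>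

definition flags :: "('k::field \<Rightarrow> 'v::ab_group_add \<Rightarrow> 'v) \<Rightarrow> nat \<Rightarrow> 'v set list set" where
  "flags scale n = {F. length F = Suc n \<and> (\<forall>i\<le>n. module.subspace scale (F ! i)) \<and>
     F ! 0 = {0} \<and> F ! n = UNIV \<and> (\<forall>i<n. F ! i \<subseteq> F ! Suc i)}"

definition GL :: "('k::field \<Rightarrow> 'v::ab_group_add \<Rightarrow> 'v) \<Rightarrow> ('v \<Rightarrow> 'v) set" where
  "GL scale = {g. Vector_Spaces.linear scale scale g \<and> bij g}"

text \<open>Functions on pairs of flags are extensional (\<^const>\<open>undefined\<close> elsewhere), so that equality
  of ring elements is equality of functions on pairs of flags.\<close>

definition schur_ring ::
  "('k::field \<Rightarrow> 'v::ab_group_add \<Rightarrow> 'v) \<Rightarrow> nat \<Rightarrow> ('v set list \<times> 'v set list \<Rightarrow> int) ring" where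
  "schur_ring scale n = (let Y = flags scale n in
    \<lparr>carrier = {f \<in> Y \<times> Y \<rightarrow>\<^sub>E UNIV.
        \<forall>g\<in>GL scale. \<forall>F\<in>Y. \<forall>F'\<in>Y. f (map (image g) F, map (image g) F') = f (F, F')},
     monoid.mult = (\<lambda>f g. \<lambda>(F, F'')\<in>Y \<times> Y. \<Sum>F'\<in>Y. f (F, F') * g (F', F'')),
     one = (\<lambda>(F, F')\<in>Y \<times> Y. if F = F' then 1 else 0),
     ring.zero = (\<lambda>p\<in>Y \<times> Y. 0),
     ring.add = (\<lambda>f g. \<lambda>p\<in>Y \<times> Y. f p + g p)\<rparr>)"

text \<open>Subspaces over the large field and subspaces over the small field are both sets of vectors of
  the same type, so the inclusion of flags is literally a subset inclusion, and pulling back along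
  it is restriction to the pairs of flags of the space \<open>scale\<close> over the large field.\<close>

definition flag_restrict ::
  "('k::field \<Rightarrow> 'v::ab_group_add \<Rightarrow> 'v) \<Rightarrow> nat \<Rightarrow>
   ('v set list \<times> 'v set list \<Rightarrow> int) \<Rightarrow> 'v set list \<times> 'v set list \<Rightarrow> int" where
  "flag_restrict scale n f = restrict f (flags scale n \<times> flags scale n)"

section \<open>The coefficient ring\<close>

text \<open>The roots of the \<open>k\<close>-th cyclotomic polynomial are the complex numbers of exact
  multiplicative order \<open>k\<close>.\<close>

definition cyclotomic_poly :: "nat \<Rightarrow> complex poly" where
  "cyclotomic_poly k = (\<Prod>\<zeta> | \<zeta> ^ k = 1 \<and> (\<forall>j. 0 < j \<and> j < k \<longrightarrow> \<zeta> ^ j \<noteq> 1). [:- \<zeta>, 1:])"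

definition laurent_subring :: "complex \<Rightarrow> complex ring" where
  "laurent_subring e =
     ring_of_type_algebra\<lparr>carrier := generate_ring ring_of_type_algebra {e, inverse e}\<rparr>"

definition coeff_ring :: "nat \<Rightarrow> complex \<Rightarrow> complex set ring" where
  "coeff_ring l e =
     laurent_subring e Quot (PIdl\<^bsub>laurent_subring e\<^esub> (poly (cyclotomic_poly (2 * l)) e))"

section \<open>Associative algebras and base change from the integers\<close>

text \<open>The locale \<open>algebra\<close> of HOL-Algebra only covers commutative algebras.\<close>

locale assoc_algebra = Module.module R M + M?: ring M
  for R (structure) and M (structure) +
  assumes smult_mult_left: "\<lbrakk>a \<in> carrier R; x \<in> carrier M; y \<in> carrier M\<rbrakk> \<Longrightarrow>
      (a \<odot>\<^bsub>M\<^esub> x) \<otimes>\<^bsub>M\<^esub> y = a \<odot>\<^bsub>M\<^esub> (x \<otimes>\<^bsub>M\<^esub> y)"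
    and smult_mult_right: "\<lbrakk>a \<in> carrier R; x \<in> carrier M; y \<in> carrier M\<rbrakk> \<Longrightarrow>
      x \<otimes>\<^bsub>M\<^esub> (a \<odot>\<^bsub>M\<^esub> y) = a \<odot>\<^bsub>M\<^esub> (x \<otimes>\<^bsub>M\<^esub> y)"

locale assoc_algebra_hom = M: assoc_algebra R M + N: assoc_algebra R N
  for R and M and N and h +
  assumes hom_ring: "h \<in> ring_hom M N"
    and hom_smult: "\<lbrakk>a \<in> carrier R; x \<in> carrier M\<rbrakk> \<Longrightarrow> h (a \<odot>\<^bsub>M\<^esub> x) = a \<odot>\<^bsub>N\<^esub> h x"

text \<open>The tensor product over the integers of rings \<open>A\<close> and \<open>B\<close> is the free abelian group on
  \<open>carrier A \<times> carrier B\<close> modulo the subgroup generated by the biadditivity relations. Its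
  multiplication, determined by \<open>(a \<otimes> b)(a' \<otimes> b') = aa' \<otimes> bb'\<close>, is induced by that of the free
  abelian group on the product of the multiplicative monoids.\<close>

definition pair_ring ::
  "('a, 'm) ring_scheme \<Rightarrow> ('b, 'n) ring_scheme \<Rightarrow> ('a \<times> 'b \<Rightarrow>\<^sub>0 int) ring" where
  "pair_ring A B =
    \<lparr>carrier = carrier (free_Abelian_group (carrier A \<times> carrier B)),
     monoid.mult = (\<lambda>c d. frag_extend (\<lambda>(a, b).
               frag_extend (\<lambda>(a', b'). frag_of (a \<otimes>\<^bsub>A\<^esub> a', b \<otimes>\<^bsub>B\<^esub> b')) d) c),
     one = frag_of (\<one>\<^bsub>A\<^esub>, \<one>\<^bsub>B\<^esub>),
     ring.zero = 0,
     ring.add = (+)\<rparr>"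

definition tensor_relations ::
  "('a, 'm) ring_scheme \<Rightarrow> ('b, 'n) ring_scheme \<Rightarrow> ('a \<times> 'b \<Rightarrow>\<^sub>0 int) set" where
  "tensor_relations A B =
    {frag_of (a \<oplus>\<^bsub>A\<^esub> a', b) - frag_of (a, b) - frag_of (a', b) |a a' b.
       a \<in> carrier A \<and> a' \<in> carrier A \<and> b \<in> carrier B} \<union>
    {frag_of (a, b \<oplus>\<^bsub>B\<^esub> b') - frag_of (a, b) - frag_of (a, b') |a b b'.
       a \<in> carrier A \<and> b \<in> carrier B \<and> b' \<in> carrier B}"

definition tensor_kernel ::
  "('a, 'm) ring_scheme \<Rightarrow> ('b, 'n) ring_scheme \<Rightarrow> ('a \<times> 'b \<Rightarrow>\<^sub>0 int) set" where
  "tensor_kernel A B =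
     generate (free_Abelian_group (carrier A \<times> carrier B)) (tensor_relations A B)"

definition pure_tensor ::
  "('a, 'm) ring_scheme \<Rightarrow> ('b, 'n) ring_scheme \<Rightarrow> 'a \<Rightarrow> 'b \<Rightarrow> ('a \<times> 'b \<Rightarrow>\<^sub>0 int) set" where
  "pure_tensor A B a b = tensor_kernel A B +>\<^bsub>pair_ring A B\<^esub> frag_of (a, b)"

text \<open>The scalar \<open>a\<close> acts as multiplication by \<open>a \<otimes> 1\<close>.\<close>

definition base_change ::
  "('a, 'm) ring_scheme \<Rightarrow> ('b, 'n) ring_scheme \<Rightarrow> ('a, ('a \<times> 'b \<Rightarrow>\<^sub>0 int) set) module" where
  "base_change A B = (let T = pair_ring A B Quot tensor_kernel A B in
     ring.extend T \<lparr>module.smult = (\<lambda>a Y. pure_tensor A B a \<one>\<^bsub>B\<^esub> \<otimes>\<^bsub>T\<^esub> Y)\<rparr>)"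

text \<open>The map \<open>id \<otimes> \<phi>\<close>, i.e. \<open>a \<otimes> b \<mapsto> a \<otimes> \<phi> b\<close>. For additive \<open>\<phi>\<close> the image of a coset
  under the map of free groups lies in a single coset.\<close>

definition base_change_map ::
  "('a, 'm) ring_scheme \<Rightarrow> ('b, 'n) ring_scheme \<Rightarrow> ('c, 'p) ring_scheme \<Rightarrow> ('b \<Rightarrow> 'c) \<Rightarrow>
   ('a \<times> 'b \<Rightarrow>\<^sub>0 int) set \<Rightarrow> ('a \<times> 'c \<Rightarrow>\<^sub>0 int) set" where
  "base_change_map A B C \<phi> Y = the_elem ((\<lambda>c. tensor_kernel A C +>\<^bsub>pair_ring A C\<^esub>
     frag_extend (\<lambda>(a, b). frag_of (a, \<phi> b)) c) ` Y)"

end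

theory Submission
  imports Defs
begin

text \<open>Scalar multiplication by the units of the large field \<open>K\<close> acts on the flags of \<open>W\<close>; its fixed
  points are the flags of \<open>V\<close>. Since invariant functions are constant along this action when the
  other flag is fixed, the convolution over all flags of \<open>W\<close> differs from the one over the flags of
  \<open>V\<close> by a sum over nontrivial orbits. The stabilizer of a flag consists of the units of an
  intermediate field with \<open>q\<^sup>d\<close> elements, so a nontrivial orbit has
  \<open>(q\<^sup>l - 1) / (q\<^sup>d - 1) = (\<Sum>j<l/d. q\<^sup>d\<^sup>j)\<close> elements with \<open>d\<close> a proper divisor of \<open>l\<close>. As
  \<open>(x\<^sup>2\<^sup>l - 1) / (x\<^sup>2\<^sup>d - 1)\<close> is divisible by the \<open>2l\<close>-th cyclotomic polynomial over the integers,
  this number vanishes in the coefficient ring. Since the integers vanishing there are the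
  multiples of a single \<open>m\<close>, the difference of the two convolutions is \<open>m\<close> times an invariant
  function, and hence is zero after base change.\<close>

section \<open>Base change from the integers\<close>

lemma frag_extend_fun_diff:
  "frag_extend (\<lambda>x. f x - g x) c = frag_extend f c - frag_extend g c"
  by (induction c rule: frag_induction[OF subset_UNIV]) (simp_all add: frag_extend_diff)

text \<open>Closure under differences covers sums and negatives at once, so a biadditive identity in
  \<open>pair_ring\<close> has to be checked on pairs only.\<close>

lemma frag_induction_carrier [consumes 1, case_names zero one diff]:
  assumes "c \<in> carrier (pair_ring A B)" "P 0"
    "\<And>a b. \<lbrakk>a \<in> carrier A; b \<in> carrier B\<rbrakk> \<Longrightarrow> P (frag_of (a, b))"
    "\<And>x y. \<lbrakk>P x; P y\<rbrakk> \<Longrightarrow> P (x - y)"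
  shows "P c"
  by (rule frag_induction[of c "carrier A \<times> carrier B"]) (use assms in \<open>auto simp: pair_ring_def\<close>)

lemma pair_ring_simps:
  "x \<in> carrier (pair_ring A B) \<longleftrightarrow> Poly_Mapping.keys x \<subseteq> carrier A \<times> carrier B"
  "\<zero>\<^bsub>pair_ring A B\<^esub> = 0" "x \<oplus>\<^bsub>pair_ring A B\<^esub> y = x + y"
  "\<one>\<^bsub>pair_ring A B\<^esub> = frag_of (\<one>\<^bsub>A\<^esub>, \<one>\<^bsub>B\<^esub>)"
  by (simp_all add: pair_ring_def)

lemma pair_ring_mult_of [simp]:
  "frag_of (a, b) \<otimes>\<^bsub>pair_ring A B\<^esub> frag_of (a', b') = frag_of (a \<otimes>\<^bsub>A\<^esub> a', b \<otimes>\<^bsub>B\<^esub> b')"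
  by (simp add: pair_ring_def)

text \<open>The second factor sits inside the function of the outer \<open>frag_extend\<close>, so
  its distributivity rests on \<open>frag_extend_fun_diff\<close>, additivity in the function
  instead of the argument.\<close>

lemma pair_ring_mult_diff:
  "(x - y) \<otimes>\<^bsub>pair_ring A B\<^esub> z = x \<otimes>\<^bsub>pair_ring A B\<^esub> z - y \<otimes>\<^bsub>pair_ring A B\<^esub> z"
  "z \<otimes>\<^bsub>pair_ring A B\<^esub> (x - y) = z \<otimes>\<^bsub>pair_ring A B\<^esub> x - z \<otimes>\<^bsub>pair_ring A B\<^esub> y"
  by (simp_all add: pair_ring_def frag_extend_diff case_prod_beta' frag_extend_fun_diff)

lemma pair_ring_mult_zero [simp]:
  "0 \<otimes>\<^bsub>pair_ring A B\<^esub> z = 0" "z \<otimes>\<^bsub>pair_ring A B\<^esub> 0 = 0"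
  using pair_ring_mult_diff(1)[of A B z z z] pair_ring_mult_diff(2)[of A B z z z] by simp_all

lemma pair_ring_mult_minus:
  "(- x) \<otimes>\<^bsub>pair_ring A B\<^esub> z = - (x \<otimes>\<^bsub>pair_ring A B\<^esub> z)"
  "z \<otimes>\<^bsub>pair_ring A B\<^esub> (- x) = - (z \<otimes>\<^bsub>pair_ring A B\<^esub> x)"
  using pair_ring_mult_diff(1)[of A B 0 x z] pair_ring_mult_diff(2)[of A B z 0 x] by simp_all

lemma pair_ring_mult_add:
  "(x + y) \<otimes>\<^bsub>pair_ring A B\<^esub> z = x \<otimes>\<^bsub>pair_ring A B\<^esub> z + y \<otimes>\<^bsub>pair_ring A B\<^esub> z"
  "z \<otimes>\<^bsub>pair_ring A B\<^esub> (x + y) = z \<otimes>\<^bsub>pair_ring A B\<^esub> x + z \<otimes>\<^bsub>pair_ring A B\<^esub> y"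
  using pair_ring_mult_diff(1)[of A B x "- y" z] pair_ring_mult_diff(2)[of A B z x "- y"]
  by (simp_all add: pair_ring_mult_minus)

lemma frag_of_in_pair_ring [simp]:
  "frag_of (a, b) \<in> carrier (pair_ring A B) \<longleftrightarrow> a \<in> carrier A \<and> b \<in> carrier B"
  by (simp add: pair_ring_simps)

lemma zero_in_pair_ring [simp]: "0 \<in> carrier (pair_ring A B)"
  by (simp add: pair_ring_simps)

lemma minus_in_pair_ring [simp]:
  "- x \<in> carrier (pair_ring A B) \<longleftrightarrow> x \<in> carrier (pair_ring A B)"
  by (simp add: pair_ring_simps)

lemma add_in_pair_ring:
  "\<lbrakk>x \<in> carrier (pair_ring A B); y \<in> carrier (pair_ring A B)\<rbrakk> \<Longrightarrow> x + y \<in> carrier (pair_ring A B)"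
  using keys_add[of x y] by (auto simp: pair_ring_simps)

lemma diff_in_pair_ring:
  "\<lbrakk>x \<in> carrier (pair_ring A B); y \<in> carrier (pair_ring A B)\<rbrakk> \<Longrightarrow> x - y \<in> carrier (pair_ring A B)"
  using keys_diff[of x y] by (auto simp: pair_ring_simps)

section \<open>The tensor product as a quotient ring and as an algebra over \<open>A\<close>\<close>

locale tensor_rings = A: cring A + B: ring B
  for A :: "('a, 'm) ring_scheme" and B :: "('b, 'n) ring_scheme"
begin

abbreviation "P \<equiv> pair_ring A B"
abbreviation "K \<equiv> tensor_kernel A B"
abbreviation "T \<equiv> P Quot K"

lemma mult_closed: "\<lbrakk>x \<in> carrier P; y \<in> carrier P\<rbrakk> \<Longrightarrow> x \<otimes>\<^bsub>P\<^esub> y \<in> carrier P"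
proof (induction x rule: frag_induction_carrier)
  case (one a b)
  from \<open>y \<in> carrier P\<close> show ?case
    by (induction y rule: frag_induction_carrier)
       (use one in \<open>auto simp: pair_ring_mult_diff diff_in_pair_ring\<close>)
qed (auto simp: pair_ring_mult_diff diff_in_pair_ring)

lemma mult_assoc:
  assumes "x \<in> carrier P" "y \<in> carrier P" "z \<in> carrier P"
  shows "x \<otimes>\<^bsub>P\<^esub> y \<otimes>\<^bsub>P\<^esub> z = x \<otimes>\<^bsub>P\<^esub> (y \<otimes>\<^bsub>P\<^esub> z)"
  using assms(1)
proof (induction x rule: frag_induction_carrier)
  case (one a b)
  note ab = this
  from assms(2) show ?case
  proof (induction y rule: frag_induction_carrier)
    case (one c d)
    from assms(3) show ?case
      by (induction z rule: frag_induction_carrier)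
        (use one ab in \<open>auto simp: pair_ring_mult_diff A.m_assoc B.m_assoc\<close>)
  qed (auto simp: pair_ring_mult_diff)
qed (auto simp: pair_ring_mult_diff)

lemma ring_P: "ring P"
proof (rule ringI)
  show "abelian_group P"
  proof (rule abelian_groupI)
    show "\<exists>y\<in>carrier P. y \<oplus>\<^bsub>P\<^esub> x = \<zero>\<^bsub>P\<^esub>" if "x \<in> carrier P" for x
      by (rule bexI[of _ "- x"]) (use that in \<open>auto simp: pair_ring_simps(2,3)\<close>)
  qed (auto simp: pair_ring_simps(2,3) add_in_pair_ring algebra_simps)
  show "Group.monoid P"
  proof (rule monoidI)
    show "\<one>\<^bsub>P\<^esub> \<otimes>\<^bsub>P\<^esub> x = x" if "x \<in> carrier P" for x
      using that by (induction x rule: frag_induction_carrier)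
        (auto simp: pair_ring_mult_diff pair_ring_simps(4))
    show "x \<otimes>\<^bsub>P\<^esub> \<one>\<^bsub>P\<^esub> = x" if "x \<in> carrier P" for x
      using that by (induction x rule: frag_induction_carrier)
        (auto simp: pair_ring_mult_diff pair_ring_simps(4))
  qed (auto simp: mult_closed mult_assoc pair_ring_simps(4))
qed (auto simp: pair_ring_simps(3) pair_ring_mult_add)

lemma a_minus_P: 
  assumes "x \<in> carrier P" "y \<in> carrier P"
  shows "x \<ominus>\<^bsub>P\<^esub> y = x - y"
proof -
  interpret P: ring P by (rule ring_P)
  have "\<ominus>\<^bsub>P\<^esub> y = - y"
    by (rule P.minus_equality) (use assms in \<open>auto simp: pair_ring_simps(2,3)\<close>)
  then show ?thesis
    by (simp add: P.minus_eq pair_ring_simps(3))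
qed

lemma relations_in_P: "x \<in> tensor_relations A B \<Longrightarrow> x \<in> carrier P"
  by (auto simp: tensor_relations_def intro!: diff_in_pair_ring)

lemma add_monoid_P: "add_monoid P = free_Abelian_group (carrier A \<times> carrier B)"
  by (simp add: pair_ring_def free_Abelian_group_def)

lemma subgroup_K: "subgroup K (add_monoid P)"
  unfolding add_monoid_P tensor_kernel_def
  by (rule group.generate_is_subgroup[OF group_free_Abelian_group])
     (use relations_in_P in \<open>auto simp: pair_ring_simps(1)\<close>)

lemma K_in_P: "x \<in> K \<Longrightarrow> x \<in> carrier P"
  using subgroup.subset[OF subgroup_K] by auto

lemma K_add: "\<lbrakk>x \<in> K; y \<in> K\<rbrakk> \<Longrightarrow> x + y \<in> K"
  using subgroup.m_closed[OF subgroup_K] by (simp add: pair_ring_simps)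

lemma K_zero [simp]: "0 \<in> K"
  using subgroup.one_closed[OF subgroup_K] by (simp add: pair_ring_simps)

lemma K_minus: "x \<in> K \<Longrightarrow> - x \<in> K"
  using subgroup.m_inv_closed[OF subgroup_K[unfolded add_monoid_P], of x] K_in_P[of x]
  by (simp add: pair_ring_simps)

lemma K_diff: "\<lbrakk>x \<in> K; y \<in> K\<rbrakk> \<Longrightarrow> x - y \<in> K"
  using K_add[OF _ K_minus] by simp

lemma K_relation: "x \<in> tensor_relations A B \<Longrightarrow> x \<in> K"
  by (simp add: tensor_kernel_def generate.incl)

text \<open>The inverse and product cases of \<open>generate\<close> both reduce to closure under
  differences once \<open>Q 0\<close> is known.\<close>

lemma K_induct [consumes 1, case_names zero rel diff]:
  assumes "x \<in> K" "Q 0" "\<And>x. x \<in> tensor_relations A B \<Longrightarrow> Q x"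
    "\<And>x y. \<lbrakk>Q x; Q y\<rbrakk> \<Longrightarrow> Q (x - y)"
  shows "Q x"
proof -
  have minus: "Q (- x)" if "Q x" for x
    using assms(4)[OF assms(2) that] by simp
  show ?thesis
    using assms(1) unfolding tensor_kernel_def
  proof (induction x rule: generate.induct)
    case one
    then show ?case using assms(2) by simp
  next
    case (incl h)
    then show ?case by (rule assms(3))
  next
    case (inv h)
    then show ?case
      using minus[OF assms(3)[OF inv]] relations_in_P[OF inv] by (simp add: pair_ring_simps)
  next
    case (eng h1 h2)
    then show ?case
      using assms(4)[OF eng(3) minus[OF eng(4)]] by simp
  qed
qed

lemma relation_left:
  "\<lbrakk>a \<in> carrier A; a' \<in> carrier A; b \<in> carrier B\<rbrakk> \<Longrightarrow>
    frag_of (a \<oplus>\<^bsub>A\<^esub> a', b) - frag_of (a, b) - frag_of (a', b) \<in> tensor_relations A B"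
  unfolding tensor_relations_def by blast

lemma relation_right:
  "\<lbrakk>a \<in> carrier A; b \<in> carrier B; b' \<in> carrier B\<rbrakk> \<Longrightarrow>
    frag_of (a, b \<oplus>\<^bsub>B\<^esub> b') - frag_of (a, b) - frag_of (a, b') \<in> tensor_relations A B"
  unfolding tensor_relations_def by blast

text \<open>By distributivity in one of the two rings, a biadditivity relation times a pair is again
  a single relation. Hence the additive subgroup they generate is already a two-sided ideal.\<close>

lemma relation_mult:
  assumes "x \<in> tensor_relations A B" and ab: "a \<in> carrier A" "b \<in> carrier B"
  shows "x \<otimes>\<^bsub>P\<^esub> frag_of (a, b) \<in> tensor_relations A B"
    "frag_of (a, b) \<otimes>\<^bsub>P\<^esub> x \<in> tensor_relations A B"
proof -
  consider
    (left) c c' d where "c \<in> carrier A" "c' \<in> carrier A" "d \<in> carrier B"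
      "x = frag_of (c \<oplus>\<^bsub>A\<^esub> c', d) - frag_of (c, d) - frag_of (c', d)"
  | (right) c d d' where "c \<in> carrier A" "d \<in> carrier B" "d' \<in> carrier B"
      "x = frag_of (c, d \<oplus>\<^bsub>B\<^esub> d') - frag_of (c, d) - frag_of (c, d')"
    using assms(1) unfolding tensor_relations_def by blast
  then show "x \<otimes>\<^bsub>P\<^esub> frag_of (a, b) \<in> tensor_relations A B"
    "frag_of (a, b) \<otimes>\<^bsub>P\<^esub> x \<in> tensor_relations A B"
    by (cases; simp add: ab pair_ring_mult_diff A.l_distr B.l_distr A.r_distr B.r_distr
        relation_left relation_right)+
qed

lemma ideal_K: "ideal K P"
proof (rule idealI[OF ring_P subgroup_K])
  fix x y assume x: "x \<in> K" and y: "y \<in> carrier P"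
  from y show "x \<otimes>\<^bsub>P\<^esub> y \<in> K"
  proof (induction y rule: frag_induction_carrier)
    case (one a b)
    from x show ?case
      by (induction x rule: K_induct)
        (auto simp: pair_ring_mult_diff K_diff one intro!: K_relation relation_mult)
  qed (auto simp: pair_ring_mult_diff K_diff)
  from y show "y \<otimes>\<^bsub>P\<^esub> x \<in> K"
  proof (induction y rule: frag_induction_carrier)
    case (one a b)
    from x show ?case
      by (induction x rule: K_induct)
        (auto simp: pair_ring_mult_diff K_diff one intro!: K_relation relation_mult)
  qed (auto simp: pair_ring_mult_diff K_diff)
qed

lemma rcos_eq_iff:
  "\<lbrakk>x \<in> carrier P; y \<in> carrier P\<rbrakk> \<Longrightarrow> K +>\<^bsub>P\<^esub> x = K +>\<^bsub>P\<^esub> y \<longleftrightarrow> x - y \<in> K"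
  using ring.quotient_eq_iff_same_a_r_cos[OF ring_P ideal_K] by (simp add: a_minus_P)

lemma K_add_left:
  assumes "a \<in> carrier A" "a' \<in> carrier A" "b \<in> carrier B"
  shows "frag_of (a \<oplus>\<^bsub>A\<^esub> a', b) - frag_of (a, b) - frag_of (a', b) \<in> K"
  using assms by (intro K_relation relation_left)

lemma K_add_right:
  assumes "a \<in> carrier A" "b \<in> carrier B" "b' \<in> carrier B"
  shows "frag_of (a, b \<oplus>\<^bsub>B\<^esub> b') - frag_of (a, b) - frag_of (a, b') \<in> K"
  using assms by (intro K_relation relation_right)

text \<open>The additivity relation for 0 + 0 collapses to minus this generator.\<close>

lemma K_zero_left:
  assumes "b \<in> carrier B" shows "frag_of (\<zero>\<^bsub>A\<^esub>, b) \<in> K"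
  using K_minus[OF K_add_left[of "\<zero>\<^bsub>A\<^esub>" "\<zero>\<^bsub>A\<^esub>" b]] assms by simp

lemma K_zero_right:
  assumes "a \<in> carrier A" shows "frag_of (a, \<zero>\<^bsub>B\<^esub>) \<in> K"
  using K_minus[OF K_add_right[of a "\<zero>\<^bsub>B\<^esub>" "\<zero>\<^bsub>B\<^esub>"]] assms by simp

lemma K_nat_balanced:
  fixes n :: nat
  assumes "a \<in> carrier A" "b \<in> carrier B"
  shows "frag_of ([n] \<cdot>\<^bsub>A\<^esub> a, b) - frag_of (a, [n] \<cdot>\<^bsub>B\<^esub> b) \<in> K"
proof (induction n)
  case 0
  show ?case using assms by (simp add: K_diff K_zero_left K_zero_right)
next
  case (Suc n)
  \<comment> \<open>One summand is split off on each side by a relation; the two copies of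
    \<open>frag_of (a, b)\<close> cancel, leaving the case of n.\<close>
  have "frag_of ([Suc n] \<cdot>\<^bsub>A\<^esub> a, b) - frag_of (a, [Suc n] \<cdot>\<^bsub>B\<^esub> b) =
    (frag_of ([n] \<cdot>\<^bsub>A\<^esub> a \<oplus>\<^bsub>A\<^esub> a, b) - frag_of ([n] \<cdot>\<^bsub>A\<^esub> a, b) - frag_of (a, b)) -
    (frag_of (a, [n] \<cdot>\<^bsub>B\<^esub> b \<oplus>\<^bsub>B\<^esub> b) - frag_of (a, [n] \<cdot>\<^bsub>B\<^esub> b) - frag_of (a, b)) +
    (frag_of ([n] \<cdot>\<^bsub>A\<^esub> a, b) - frag_of (a, [n] \<cdot>\<^bsub>B\<^esub> b))"
    by simp
  also have "\<dots> \<in> K"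
    by (intro K_add K_diff K_add_left K_add_right Suc.IH)
       (use assms in auto)
  finally show ?case .
qed

text \<open>Moving n across the tensor sign gives a \<otimes> n b' = n a \<otimes> b' = 0. This
  turns a congruence modulo n in \<open>B\<close> into an equality after tensoring with an element
  killed by n.\<close>

lemma K_torsion:
  fixes n :: nat
  assumes "a \<in> carrier A" "b \<in> carrier B" "b' \<in> carrier B" "[n] \<cdot>\<^bsub>A\<^esub> a = \<zero>\<^bsub>A\<^esub>"
  shows "frag_of (a, b \<oplus>\<^bsub>B\<^esub> [n] \<cdot>\<^bsub>B\<^esub> b') - frag_of (a, b) \<in> K"
proof -
  have "frag_of (a, b \<oplus>\<^bsub>B\<^esub> [n] \<cdot>\<^bsub>B\<^esub> b') - frag_of (a, b) =
    (frag_of (a, b \<oplus>\<^bsub>B\<^esub> [n] \<cdot>\<^bsub>B\<^esub> b') - frag_of (a, b) - frag_of (a, [n] \<cdot>\<^bsub>B\<^esub> b')) -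
    (frag_of ([n] \<cdot>\<^bsub>A\<^esub> a, b') - frag_of (a, [n] \<cdot>\<^bsub>B\<^esub> b')) + frag_of (\<zero>\<^bsub>A\<^esub>, b')"
    using assms(4) by simp
  also have "\<dots> \<in> K"
    by (intro K_add K_diff K_add_right K_nat_balanced K_zero_left) (use assms in auto)
  finally show ?thesis .
qed

lemma base_change_simps [simp]:
  "carrier (base_change A B) = carrier T"
  "monoid.mult (base_change A B) = monoid.mult T"
  "one (base_change A B) = one T"
  "ring.zero (base_change A B) = ring.zero T"
  "ring.add (base_change A B) = ring.add T"
  "a \<odot>\<^bsub>base_change A B\<^esub> x = pure_tensor A B a \<one>\<^bsub>B\<^esub> \<otimes>\<^bsub>T\<^esub> x"
  by (simp_all add: base_change_def Let_def ring.defs)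

lemma ring_T: "ring T"
  by (rule ideal.quotient_is_ring[OF ideal_K])

lemma T_cases:
  assumes "x \<in> carrier T"
  obtains c where "c \<in> carrier P" "x = K +>\<^bsub>P\<^esub> c"
  using assms by (auto simp: FactRing_def A_RCOSETS_def')

lemma pure_tensor_closed:
  "\<lbrakk>a \<in> carrier A; b \<in> carrier B\<rbrakk> \<Longrightarrow> pure_tensor A B a b \<in> carrier T"
  by (auto simp: FactRing_def A_RCOSETS_def' pure_tensor_def)

lemma rcos_hom: "(+>\<^bsub>P\<^esub>) K \<in> ring_hom P T"
  by (rule ideal.rcos_ring_hom[OF ideal_K])

lemma pure_tensor_add:
  assumes "a \<in> carrier A" "a' \<in> carrier A" "b \<in> carrier B"
  shows "pure_tensor A B (a \<oplus>\<^bsub>A\<^esub> a') b = pure_tensor A B a b \<oplus>\<^bsub>T\<^esub> pure_tensor A B a' b"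
proof -
  have "pure_tensor A B (a \<oplus>\<^bsub>A\<^esub> a') b = K +>\<^bsub>P\<^esub> (frag_of (a, b) \<oplus>\<^bsub>P\<^esub> frag_of (a', b))"
    unfolding pure_tensor_def
    using K_add_left[OF assms]
    by (subst rcos_eq_iff)
      (use assms in \<open>auto simp: pair_ring_simps(3) algebra_simps intro: add_in_pair_ring\<close>)
  also have "\<dots> = pure_tensor A B a b \<oplus>\<^bsub>T\<^esub> pure_tensor A B a' b"
    unfolding pure_tensor_def
    using assms by (intro ring_hom_add[OF rcos_hom]) auto
  finally show ?thesis .
qed

lemma pure_tensor_mult:
  assumes "a \<in> carrier A" "a' \<in> carrier A" "b \<in> carrier B" "b' \<in> carrier B"
  shows "pure_tensor A B a b \<otimes>\<^bsub>T\<^esub> pure_tensor A B a' b' = pure_tensor A B (a \<otimes>\<^bsub>A\<^esub> a') (b \<otimes>\<^bsub>B\<^esub> b')"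
  unfolding pure_tensor_def
  using assms ring_hom_mult[OF rcos_hom, of "frag_of (a, b)" "frag_of (a', b')"] by simp

lemma pure_tensor_one: "pure_tensor A B \<one>\<^bsub>A\<^esub> \<one>\<^bsub>B\<^esub> = \<one>\<^bsub>T\<^esub>"
  unfolding pure_tensor_def using ring_hom_one[OF rcos_hom] by (simp add: pair_ring_simps(4))

text \<open>Commutativity of \<open>A\<close> makes a \<otimes> 1 commute with every generator; this
  is what lets scalars be pulled out of the right factor of a product.\<close>

lemma pure_tensor_central:
  assumes "a \<in> carrier A" "x \<in> carrier T"
  shows "pure_tensor A B a \<one>\<^bsub>B\<^esub> \<otimes>\<^bsub>T\<^esub> x = x \<otimes>\<^bsub>T\<^esub> pure_tensor A B a \<one>\<^bsub>B\<^esub>"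
proof -
  obtain c where c: "c \<in> carrier P" "x = K +>\<^bsub>P\<^esub> c"
    using assms(2) by (rule T_cases)
  have "frag_of (a, \<one>\<^bsub>B\<^esub>) \<otimes>\<^bsub>P\<^esub> c = c \<otimes>\<^bsub>P\<^esub> frag_of (a, \<one>\<^bsub>B\<^esub>)"
    using c(1) by (induction c rule: frag_induction_carrier)
      (use assms in \<open>auto simp: pair_ring_mult_diff A.m_comm\<close>)
  then show ?thesis
    unfolding pure_tensor_def c(2) using assms c(1)
    by (simp flip: ring_hom_mult[OF rcos_hom])
qed

lemma assoc_algebra_base_change: "assoc_algebra A (base_change A B)"
proof -
  interpret T: ring T by (rule ring_T)
  note closed = pure_tensor_closed[OF _ B.one_closed]
  have abel: "abelian_group (base_change A B)"
    by (rule abelian_groupI) (auto simp: T.a_assoc T.a_comm T.a_lcomm intro: T.l_neg T.a_inv_closed)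
  moreover have "Group.monoid (base_change A B)"
    by (rule monoidI) (auto simp: T.m_assoc)
  ultimately have "ring (base_change A B)"
    by (rule ringI) (auto simp: T.l_distr T.r_distr)
  show ?thesis
  proof (intro assoc_algebra.intro module.intro assoc_algebra_axioms.intro module_axioms.intro)
    show "cring A" by (rule A.is_cring)
    show "abelian_group (base_change A B)" "ring (base_change A B)"
      by fact+
  next
    fix a x y
    assume "a \<in> carrier A" "x \<in> carrier (base_change A B)" "y \<in> carrier (base_change A B)"
    then show "x \<otimes>\<^bsub>base_change A B\<^esub> (a \<odot>\<^bsub>base_change A B\<^esub> y) =
        a \<odot>\<^bsub>base_change A B\<^esub> (x \<otimes>\<^bsub>base_change A B\<^esub> y)"
      using closed[of a] by (simp add: pure_tensor_central[symmetric, of a x] flip: T.m_assoc)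
  next
    fix a b x assume "a \<in> carrier A" "b \<in> carrier A" "x \<in> carrier (base_change A B)"
    then show "(a \<otimes>\<^bsub>A\<^esub> b) \<odot>\<^bsub>base_change A B\<^esub> x =
        a \<odot>\<^bsub>base_change A B\<^esub> (b \<odot>\<^bsub>base_change A B\<^esub> x)"
      using pure_tensor_mult[of a b "\<one>\<^bsub>B\<^esub>" "\<one>\<^bsub>B\<^esub>"] closed by (simp flip: T.m_assoc)
  qed (simp_all add: closed pure_tensor_add T.l_distr T.r_distr T.m_assoc pure_tensor_one)
qed

end

section \<open>The map id \<otimes> \<phi> for additive \<phi>\<close>

locale tensor_map = B: tensor_rings A B + C: tensor_rings A C
  for A :: "('a, 'm) ring_scheme" and B :: "('b, 'n) ring_scheme"
    and C :: "('c, 'p) ring_scheme" +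
  fixes \<phi> :: "'b \<Rightarrow> 'c"
  assumes \<phi>_closed: "b \<in> carrier B \<Longrightarrow> \<phi> b \<in> carrier C"
    and \<phi>_add: "\<lbrakk>b \<in> carrier B; b' \<in> carrier B\<rbrakk> \<Longrightarrow> \<phi> (b \<oplus>\<^bsub>B\<^esub> b') = \<phi> b \<oplus>\<^bsub>C\<^esub> \<phi> b'"
begin

definition "\<Phi> = frag_extend (\<lambda>(a, b). frag_of (a, \<phi> b))"

lemma \<Phi>_simps [simp]:
  "\<Phi> (frag_of (a, b)) = frag_of (a, \<phi> b)" "\<Phi> (x - y) = \<Phi> x - \<Phi> y" "\<Phi> 0 = 0"
  "\<Phi> (x + y) = \<Phi> x + \<Phi> y"
  by (simp_all add: \<Phi>_def frag_extend_diff frag_extend_add)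

lemma \<Phi>_closed: "x \<in> carrier B.P \<Longrightarrow> \<Phi> x \<in> carrier C.P"
  by (induction x rule: frag_induction_carrier) (auto simp: \<phi>_closed diff_in_pair_ring)

lemma \<Phi>_K: "x \<in> B.K \<Longrightarrow> \<Phi> x \<in> C.K"
proof (induction x rule: B.K_induct)
  case (rel x)
  then show ?case
    by (auto simp: tensor_relations_def \<phi>_closed \<phi>_add intro!: C.K_add_left C.K_add_right)
qed (auto simp: C.K_diff)

text \<open>\<open>\<Phi>\<close> carries kernel to kernel, so the image of a coset is a singleton
  and \<open>the_elem\<close> returns its only member. Afterwards the map can be computed on
  representatives.\<close>

lemma base_change_map_rcos:
  assumes "x \<in> carrier B.P"
  shows "base_change_map A B C \<phi> (B.K +>\<^bsub>B.P\<^esub> x) = C.K +>\<^bsub>C.P\<^esub> \<Phi> x"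
proof -
  have eq: "C.K +>\<^bsub>C.P\<^esub> \<Phi> y = C.K +>\<^bsub>C.P\<^esub> \<Phi> x" if "y \<in> B.K +>\<^bsub>B.P\<^esub> x" for y
  proof -
    from that obtain k where k: "k \<in> B.K" "y = k + x"
      by (auto simp: a_r_coset_def' pair_ring_simps(3))
    then have y: "y \<in> carrier B.P"
      using assms by (auto intro: add_in_pair_ring B.K_in_P)
    show ?thesis
      by (subst C.rcos_eq_iff) (use k y assms \<Phi>_closed[OF y] in \<open>auto simp: \<Phi>_closed \<Phi>_K\<close>)
  qed
  have "x \<in> B.K +>\<^bsub>B.P\<^esub> x"
    using B.K_zero by (force simp: a_r_coset_def' pair_ring_simps(3))
  with eq have "(\<lambda>y. C.K +>\<^bsub>C.P\<^esub> \<Phi> y) ` (B.K +>\<^bsub>B.P\<^esub> x) = {C.K +>\<^bsub>C.P\<^esub> \<Phi> x}"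
    by blast
  then show ?thesis
    by (simp add: base_change_map_def \<Phi>_def)
qed

lemma base_change_map_pure_tensor:
  "\<lbrakk>a \<in> carrier A; b \<in> carrier B\<rbrakk> \<Longrightarrow>
    base_change_map A B C \<phi> (pure_tensor A B a b) = pure_tensor A C a (\<phi> b)"
  by (simp add: pure_tensor_def base_change_map_rcos)

text \<open>Multiplicativity of \<open>\<phi>\<close> is asked only up to the tensor kernel, because
  restriction to flags of V respects convolution only modulo an integer. Biadditivity extends the
  condition from pairs to arbitrary representatives.\<close>

lemma assoc_algebra_hom_base_change_map:
  assumes one: "\<phi> \<one>\<^bsub>B\<^esub> = \<one>\<^bsub>C\<^esub>"
    and mult: "\<And>a b b'. \<lbrakk>a \<in> carrier A; b \<in> carrier B; b' \<in> carrier B\<rbrakk> \<Longrightarrow>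
      frag_of (a, \<phi> (b \<otimes>\<^bsub>B\<^esub> b')) - frag_of (a, \<phi> b \<otimes>\<^bsub>C\<^esub> \<phi> b') \<in> C.K"
  shows "assoc_algebra_hom A (base_change A B) (base_change A C) (base_change_map A B C \<phi>)"
proof -
  let ?h = "base_change_map A B C \<phi>"
  interpret TB: ring B.T by (rule B.ring_T)
  interpret TC: ring C.T by (rule C.ring_T)
  have mult': "\<Phi> (x \<otimes>\<^bsub>B.P\<^esub> y) - \<Phi> x \<otimes>\<^bsub>C.P\<^esub> \<Phi> y \<in> C.K"
    if x: "x \<in> carrier B.P" and y: "y \<in> carrier B.P" for x y
    using x
  proof (induction x rule: frag_induction_carrier)
    case (one a b)
    note ab = one
    from y show ?case
    proof (induction y rule: frag_induction_carrier)
      case (one a' b')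
      then show ?case using ab by (simp add: mult)
    next
      case (diff x y)
      show ?case using C.K_diff[OF diff] by (simp add: pair_ring_mult_diff algebra_simps)
    qed simp
  next
    case (diff x y)
    show ?case using C.K_diff[OF diff] by (simp add: pair_ring_mult_diff algebra_simps)
  qed simp
  have rcos: "C.K +>\<^bsub>C.P\<^esub> \<Phi> x \<in> carrier C.T" if "x \<in> carrier B.P" for x
    using ring_hom_closed[OF C.rcos_hom \<Phi>_closed[OF that]] .
  have hom: "?h \<in> ring_hom B.T C.T"
  proof (rule ring_hom_memI)
    fix x y assume "x \<in> carrier B.T" "y \<in> carrier B.T"
    then obtain c d where cd: "c \<in> carrier B.P" "x = B.K +>\<^bsub>B.P\<^esub> c"
      "d \<in> carrier B.P" "y = B.K +>\<^bsub>B.P\<^esub> d"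
      by (metis B.T_cases)
    show "?h x \<in> carrier C.T"
      using cd by (simp add: base_change_map_rcos rcos)
    have "?h (x \<oplus>\<^bsub>B.T\<^esub> y) = ?h (B.K +>\<^bsub>B.P\<^esub> (c \<oplus>\<^bsub>B.P\<^esub> d))"
      using cd by (simp add: ring_hom_add[OF B.rcos_hom])
    also have "\<dots> = C.K +>\<^bsub>C.P\<^esub> (\<Phi> c \<oplus>\<^bsub>C.P\<^esub> \<Phi> d)"
      using cd by (simp add: base_change_map_rcos pair_ring_simps(3) add_in_pair_ring)
    also have "\<dots> = ?h x \<oplus>\<^bsub>C.T\<^esub> ?h y"
      using cd by (simp add: base_change_map_rcos ring_hom_add[OF C.rcos_hom] \<Phi>_closed)
    finally show "?h (x \<oplus>\<^bsub>B.T\<^esub> y) = ?h x \<oplus>\<^bsub>C.T\<^esub> ?h y" .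
    have "?h (x \<otimes>\<^bsub>B.T\<^esub> y) = ?h (B.K +>\<^bsub>B.P\<^esub> (c \<otimes>\<^bsub>B.P\<^esub> d))"
      using cd by (simp add: ring_hom_mult[OF B.rcos_hom])
    also have "\<dots> = C.K +>\<^bsub>C.P\<^esub> \<Phi> (c \<otimes>\<^bsub>B.P\<^esub> d)"
      using cd by (simp add: base_change_map_rcos B.mult_closed)
    also have "\<dots> = C.K +>\<^bsub>C.P\<^esub> (\<Phi> c \<otimes>\<^bsub>C.P\<^esub> \<Phi> d)"
      by (subst C.rcos_eq_iff) (use cd in \<open>auto simp: \<Phi>_closed B.mult_closed C.mult_closed mult'\<close>)
    also have "\<dots> = ?h x \<otimes>\<^bsub>C.T\<^esub> ?h y"
      using cd by (simp add: base_change_map_rcos ring_hom_mult[OF C.rcos_hom] \<Phi>_closed)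
    finally show "?h (x \<otimes>\<^bsub>B.T\<^esub> y) = ?h x \<otimes>\<^bsub>C.T\<^esub> ?h y" .
  next
    show "?h \<one>\<^bsub>B.T\<^esub> = \<one>\<^bsub>C.T\<^esub>"
      using base_change_map_pure_tensor[of "\<one>\<^bsub>A\<^esub>" "\<one>\<^bsub>B\<^esub>"]
      by (simp add: B.pure_tensor_one C.pure_tensor_one one)
  qed
  show ?thesis
  proof (intro assoc_algebra_hom.intro assoc_algebra_hom_axioms.intro)
    show "?h \<in> ring_hom (base_change A B) (base_change A C)"
      using hom by (simp add: ring_hom_def)
  next
    fix a x assume a: "a \<in> carrier A" and "x \<in> carrier (base_change A B)"
    then show "?h (a \<odot>\<^bsub>base_change A B\<^esub> x) = a \<odot>\<^bsub>base_change A C\<^esub> ?h x"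
      by (simp add: ring_hom_mult[OF hom] B.pure_tensor_closed base_change_map_pure_tensor one)
  qed (rule B.assoc_algebra_base_change C.assoc_algebra_base_change)+
qed

end

section \<open>Cyclotomic polynomials and the coefficient ring\<close>

text \<open>Cyclotomic polynomials are defined here through their complex roots, so integrality is a
  predicate on complex polynomials.\<close>

definition int_coeffs :: "complex poly \<Rightarrow> bool" where
  "int_coeffs p \<longleftrightarrow> (\<forall>i. coeff p i \<in> \<int>)"

lemma int_coeffs_mult: "\<lbrakk>int_coeffs p; int_coeffs q\<rbrakk> \<Longrightarrow> int_coeffs (p * q)"
  by (auto simp: int_coeffs_def coeff_mult intro!: Ints_sum Ints_mult)

lemma int_coeffs_prod: "(\<And>x. x \<in> S \<Longrightarrow> int_coeffs (f x)) \<Longrightarrow> int_coeffs (prod f S)"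
  by (induction S rule: infinite_finite_induct)
    (auto simp: int_coeffs_mult int_coeffs_def[of 1] coeff_1)

text \<open>Long division by a monic polynomial introduces no denominators. The coefficients of q
  are obtained from the top one downwards, hence the decreasing measure.\<close>

lemma int_coeffs_monic_dvd:
  assumes pq: "int_coeffs (p * q)" and p: "int_coeffs p" and monic: "lead_coeff p = 1"
  shows "int_coeffs q"
  unfolding int_coeffs_def
proof
  fix i
  let ?m = "degree p"
  show "coeff q i \<in> \<int>"
  proof (induction "Suc (degree q) - i" arbitrary: i rule: less_induct)
    case less
    show ?case
    proof (cases "degree q < i")
      case True
      then show ?thesis by (simp add: coeff_eq_0)
    next
      case False
      \<comment> \<open>In this coefficient of the product the leading 1 of p meets
        \<open>coeff q i\<close>; every other surviving term has a coefficient of q of index above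
        i.\<close>
      have "coeff (p * q) (?m + i) = (\<Sum>j\<le>?m + i. coeff p j * coeff q (?m + i - j))"
        by (rule coeff_mult)
      also have "\<dots> = (\<Sum>j\<le>?m. coeff p j * coeff q (?m + i - j))"
        by (rule sum.mono_neutral_right) (auto simp: coeff_eq_0)
      also have "\<dots> = coeff q i + (\<Sum>j<?m. coeff p j * coeff q (?m + i - j))"
        using monic by (simp add: lessThan_Suc_atMost[symmetric] del: lessThan_Suc_atMost)
      finally have "coeff q i = coeff (p * q) (?m + i) - (\<Sum>j<?m. coeff p j * coeff q (?m + i - j))"
        by simp
      moreover have "coeff q (?m + i - j) \<in> \<int>" if "j < ?m" for j
        by (rule less.hyps) (use that False in auto)
      ultimately show ?thesis
        using pq p by (auto simp: int_coeffs_def intro!: Ints_diff Ints_sum Ints_mult)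
    qed
  qed
qed

lemma prod_linear_dvd:
  fixes p :: "'a::field poly"
  assumes "finite S" "\<And>z. z \<in> S \<Longrightarrow> poly p z = 0"
  shows "(\<Prod>z\<in>S. [:- z, 1:]) dvd p"
  using assms
proof (induction S rule: finite_induct)
  case (insert z S)
  then obtain c where c: "p = (\<Prod>z\<in>S. [:- z, 1:]) * c" by (auto simp: dvd_def)
  have "poly (\<Prod>z\<in>S. [:- z, 1:]) z \<noteq> 0"
    using insert.hyps by (auto simp: poly_prod)
  then have "poly c z = 0"
    using insert.prems[of z] by (auto simp: c)
  then have "[:- z, 1:] dvd c" by (simp add: poly_eq_0_iff_dvd)
  then have "[:- z, 1:] * (\<Prod>z\<in>S. [:- z, 1:]) dvd c * (\<Prod>z\<in>S. [:- z, 1:])"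
    by (rule mult_dvd_mono) simp
  then show ?case
    by (simp only: c prod.insert[OF insert.hyps] mult.commute[of _ c])
qed simp

definition primitive_roots :: "nat \<Rightarrow> complex set" where
  "primitive_roots k = {\<zeta>. \<zeta> ^ k = 1 \<and> (\<forall>j. 0 < j \<and> j < k \<longrightarrow> \<zeta> ^ j \<noteq> 1)}"

lemma cyclotomic_poly_eq: "cyclotomic_poly k = (\<Prod>\<zeta>\<in>primitive_roots k. [:- \<zeta>, 1:])"
  by (simp add: cyclotomic_poly_def primitive_roots_def)

lemma finite_primitive_roots: "0 < k \<Longrightarrow> finite (primitive_roots k)"
  by (rule finite_subset[OF _ finite_roots_unity[of k]]) (auto simp: primitive_roots_def)

lemma monic_prod_linear: "lead_coeff (\<Prod>z\<in>S. [:- z, 1::'a::field:]) = 1"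
  by (simp add: lead_coeff_prod)

text \<open>A root of unity is primitive for its order, the least positive exponent sending it to 1;
  division with remainder shows that this order divides n.\<close>

lemma roots_of_unity_eq_UN_primitive_roots:
  assumes "0 < n"
  shows "{z::complex. z ^ n = 1} = (\<Union>d\<in>{d. d dvd n}. primitive_roots d)"
proof (intro equalityI subsetI)
  fix z :: complex assume "z \<in> {z. z ^ n = 1}"
  then have n: "0 < n \<and> z ^ n = 1" using assms by simp
  define d where "d = (LEAST d. 0 < d \<and> z ^ d = 1)"
  have d: "0 < d \<and> z ^ d = 1"
    unfolding d_def by (rule LeastI[of _ n]) (rule n)
  have min: "z ^ j \<noteq> 1" if "0 < j" "j < d" for j
    using not_less_Least[of j "\<lambda>d. 0 < d \<and> z ^ d = 1"] that unfolding d_def by blast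
  have "z ^ n = (z ^ d) ^ (n div d) * z ^ (n mod d)"
    by (simp flip: power_mult power_add)
  then have "z ^ (n mod d) = 1" using n d by simp
  then have "d dvd n"
    using min[of "n mod d"] d by (metis dvd_eq_mod_eq_0 mod_less_divisor not_gr_zero)
  then show "z \<in> (\<Union>d\<in>{d. d dvd n}. primitive_roots d)"
    using d min by (auto simp: primitive_roots_def)
qed (auto simp: primitive_roots_def power_mult elim!: dvdE)

text \<open>The product divides the right-hand side because its roots are distinct. There are n of
  them, so degrees and leading coefficients agree and the quotient is 1.\<close>

lemma prod_roots_of_unity:
  assumes "0 < n"
  shows "(\<Prod>z | z ^ n = 1. [:- z, 1::complex:]) = monom 1 n - 1"
proof -
  let ?P = "\<Prod>z | z ^ n = 1. [:- z, 1::complex:]" and ?M = "monom 1 n - 1 :: complex poly"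
  have deg: "degree ?M = n"
    using assms degree_add_eq_left[of "- 1" "monom (1 :: complex) n"] by (simp add: degree_monom_eq)
  have lead: "lead_coeff ?M = 1"
    unfolding deg using assms by (simp add: coeff_1)
  have "degree ?P = n"
    using assms by (subst degree_prod_eq_sum_degree) (auto simp: card_roots_unity_eq)
  moreover have "?P dvd ?M"
    by (rule prod_linear_dvd) (use assms in \<open>auto simp: finite_roots_unity poly_monom\<close>)
  then obtain c where c: "?M = ?P * c" by (auto simp: dvd_def)
  moreover have "?M \<noteq> 0"
  proof
    assume "?M = 0"
    from lead[unfolded this] show False by simp
  qed
  ultimately have "degree c = 0"
    using deg by (metis add_cancel_left_right degree_mult_eq mult_eq_0_iff)
  moreover have "lead_coeff c = 1"
    using lead by (simp only: c lead_coeff_mult monic_prod_linear) simp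
  ultimately show ?thesis
    using c by (metis degree_eq_zeroE lead_coeff_pCons(2) mult.right_neutral one_pCons pCons_0_0)
qed

lemma prod_cyclotomic_poly:
  assumes "0 < n"
  shows "(\<Prod>d | d dvd n. cyclotomic_poly d) = monom 1 n - 1"
proof -
  have disj: "primitive_roots i \<inter> primitive_roots j = {}" if "0 < i" "0 < j" "i \<noteq> j" for i j
    using that by (auto simp: primitive_roots_def) (metis linorder_neqE_nat)
  have "monom 1 n - 1 = (\<Prod>z\<in>(\<Union>d\<in>{d. d dvd n}. primitive_roots d). [:- z, 1::complex:])"
    by (simp add: prod_roots_of_unity[OF assms, symmetric]
        flip: roots_of_unity_eq_UN_primitive_roots[OF assms])
  also have "\<dots> = (\<Prod>d | d dvd n. cyclotomic_poly d)"
    unfolding cyclotomic_poly_eq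
    by (rule prod.UNION_disjoint)
      (use assms disj in \<open>auto simp: dvd_pos_nat finite_primitive_roots\<close>)
  finally show ?thesis ..
qed

text \<open>Strong induction: the polynomial is the quotient of x^n - 1 by the product over the
  proper divisors of n, which is monic and integral by hypothesis.\<close>

lemma int_coeffs_cyclotomic_poly: "0 < n \<Longrightarrow> int_coeffs (cyclotomic_poly n)"
proof (induction n rule: less_induct)
  case (less n)
  let ?R = "\<Prod>d\<in>{d. d dvd n} - {n}. cyclotomic_poly d"
  have "?R * cyclotomic_poly n = monom 1 n - 1"
    using prod.remove[of "{d. d dvd n}" n cyclotomic_poly] prod_cyclotomic_poly[OF less.prems]
      less.prems by (simp add: mult.commute)
  moreover have "int_coeffs (monom 1 n - 1)"
    by (auto simp: int_coeffs_def coeff_1)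
  moreover have "int_coeffs ?R"
  proof (rule int_coeffs_prod)
    fix d assume "d \<in> {d. d dvd n} - {n}"
    then show "int_coeffs (cyclotomic_poly d)"
      using less.prems dvd_imp_le[of d n] dvd_pos_nat[of n d] by (intro less.IH) auto
  qed
  moreover have "lead_coeff ?R = 1"
    by (simp add: lead_coeff_prod cyclotomic_poly_eq)
  ultimately show ?case
    using int_coeffs_monic_dvd[of ?R "cyclotomic_poly n"] by simp
qed

text \<open>The sum is (x^(2l) - 1) / (x^(2d) - 1). A primitive 2l-th root of unity kills the
  numerator but not the denominator, since 0 < 2d < 2l. Integrality of the cofactor puts its value
  at \<epsilon> into the Laurent subring.\<close>

lemma cyclotomic_poly_dvd_power_sum:
  assumes "0 < l" "l = d * e" "d < l"
  obtains r where "int_coeffs r" "(\<Sum>j<e. monom 1 (2 * d * j)) = cyclotomic_poly (2 * l) * r"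
proof -
  let ?Q = "\<Sum>j<e. monom 1 (2 * d * j) :: complex poly"
  have "cyclotomic_poly (2 * l) dvd ?Q"
    unfolding cyclotomic_poly_eq
  proof (rule prod_linear_dvd)
    fix z assume z: "z \<in> primitive_roots (2 * l)"
    have "0 < d" using assms by (cases d) auto
    then have "z ^ (2 * d) \<noteq> 1"
      using z assms by (auto simp: primitive_roots_def)
    moreover have "(z ^ (2 * d) - 1) * poly ?Q z = z ^ (2 * l) - 1"
      using power_diff_1_eq[of "z ^ (2 * d)" e]
      by (simp add: poly_sum poly_monom assms(2) power_mult)
    ultimately show "poly ?Q z = 0"
      using z by (auto simp: primitive_roots_def)
  qed (use assms in \<open>simp add: finite_primitive_roots\<close>)
  then obtain r where r: "?Q = cyclotomic_poly (2 * l) * r" by (auto simp: dvd_def)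
  have "int_coeffs ?Q"
    by (auto simp: int_coeffs_def coeff_sum intro!: Ints_sum)
  then have Qr: "int_coeffs (cyclotomic_poly (2 * l) * r)"
    by (simp only: r)
  have monic: "lead_coeff (cyclotomic_poly (2 * l)) = 1"
    by (simp only: cyclotomic_poly_eq monic_prod_linear)
  have "int_coeffs r"
    by (rule int_coeffs_monic_dvd[OF Qr int_coeffs_cyclotomic_poly monic]) (use assms(1) in simp)
  with r show ?thesis using that by blast
qed

section \<open>The Laurent subring and its cyclotomic quotient\<close>

lemma ring_of_type_algebra_simps:
  "carrier ring_of_type_algebra = UNIV" "\<one>\<^bsub>ring_of_type_algebra\<^esub> = 1"
  "\<zero>\<^bsub>ring_of_type_algebra\<^esub> = 0"
  "x \<oplus>\<^bsub>ring_of_type_algebra\<^esub> y = x + y" "x \<otimes>\<^bsub>ring_of_type_algebra\<^esub> y = x * y"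
  by (simp_all add: ring_of_type_algebra_def)

lemma laurent_subring_simps:
  "\<one>\<^bsub>laurent_subring e\<^esub> = 1" "\<zero>\<^bsub>laurent_subring e\<^esub> = 0"
  "x \<oplus>\<^bsub>laurent_subring e\<^esub> y = x + y" "x \<otimes>\<^bsub>laurent_subring e\<^esub> y = x * y"
  by (simp_all add: laurent_subring_def ring_of_type_algebra_simps)

lemma cring_laurent_subring: "cring (laurent_subring e)"
proof -
  interpret C: cring "ring_of_type_algebra :: complex ring" by (rule cring_from_type_algebra)
  have "subring (generate_ring ring_of_type_algebra {e, inverse e}) ring_of_type_algebra"
    by (rule C.generate_ring_is_subring) (simp add: ring_of_type_algebra_simps)
  then show ?thesis
    unfolding laurent_subring_def
    using C.subcring_iff[of "generate_ring ring_of_type_algebra {e, inverse e}"] C.subcringI'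
    by (simp add: ring_of_type_algebra_simps)
qed

lemma e_in_laurent_subring: "e \<in> carrier (laurent_subring e)"
  by (simp add: laurent_subring_def generate_ring.incl)

lemma poly_in_laurent_subring:
  assumes "int_coeffs p"
  shows "poly p e \<in> carrier (laurent_subring e)"
proof -
  interpret L: cring "laurent_subring e" by (rule cring_laurent_subring)
  note closed = L.zero_closed L.one_closed L.a_closed L.m_closed
  note closed' = closed[unfolded laurent_subring_simps]
  have nat: "of_nat k \<in> carrier (laurent_subring e)" for k
    by (induction k) (simp_all add: closed')
  have neg: "- x \<in> carrier (laurent_subring e)" if "x \<in> carrier (laurent_subring e)" for x
  proof -
    have "x + (\<ominus>\<^bsub>laurent_subring e\<^esub> x) = 0"
      using L.r_neg[OF that] by (simp add: laurent_subring_simps)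
    then show ?thesis
      using L.a_inv_closed[OF that] by (metis add.inverse_unique)
  qed
  have int: "c \<in> carrier (laurent_subring e)" if "c \<in> \<int>" for c
    using that
  proof (cases rule: Ints_cases)
    case (of_int k)
    then show ?thesis by (cases k) (auto simp: nat neg simp del: of_nat_Suc)
  qed
  have pow: "e ^ k \<in> carrier (laurent_subring e)" for k
    by (induction k) (simp_all add: closed' e_in_laurent_subring)
  have "(\<Sum>i\<in>I. coeff p i * e ^ i) \<in> carrier (laurent_subring e)" for I
    by (induction I rule: infinite_finite_induct)
       (use assms in \<open>auto simp: closed' pow int int_coeffs_def\<close>)
  then show ?thesis by (simp add: poly_altdef)
qed

lemma ideal_cyclotomic:
  assumes "0 < l"
  shows "ideal (PIdl\<^bsub>laurent_subring e\<^esub> (poly (cyclotomic_poly (2 * l)) e)) (laurent_subring e)"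
  by (rule cring.cgenideal_ideal[OF cring_laurent_subring])
     (use assms in \<open>auto intro!: poly_in_laurent_subring int_coeffs_cyclotomic_poly\<close>)

lemma cring_coeff_ring: "0 < l \<Longrightarrow> cring (coeff_ring l e)"
  unfolding coeff_ring_def
  by (rule ideal.quotient_is_cring[OF ideal_cyclotomic cring_laurent_subring])

text \<open>Translates membership of an integer in the cyclotomic ideal into the vanishing of a
  multiple of one.\<close>

lemma coeff_ring_nat:
  fixes k :: nat
  assumes "0 < l"
  shows "[k] \<cdot>\<^bsub>coeff_ring l e\<^esub> \<one>\<^bsub>coeff_ring l e\<^esub> =
    PIdl\<^bsub>laurent_subring e\<^esub> (poly (cyclotomic_poly (2 * l)) e) +>\<^bsub>laurent_subring e\<^esub> of_nat k"
    (is "_ = ?I +>\<^bsub>_\<^esub> _")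
proof -
  interpret A: cring "coeff_ring l e" using assms by (rule cring_coeff_ring)
  interpret I: ideal ?I "laurent_subring e" using assms by (rule ideal_cyclotomic)
  have hom: "(+>\<^bsub>laurent_subring e\<^esub>) ?I \<in> ring_hom (laurent_subring e) (coeff_ring l e)"
    unfolding coeff_ring_def by (rule I.rcos_ring_hom)
  have nat: "of_nat k \<in> carrier (laurent_subring e)" for k
    using poly_in_laurent_subring[of "[:of_nat k:]" e]
    by (auto simp: int_coeffs_def coeff_pCons split: nat.splits)
  show ?thesis
  proof (induction k)
    case 0
    show ?case using ring_hom_zero[OF hom I.ring_axioms A.ring_axioms]
      by (simp add: laurent_subring_simps)
  next
    case (Suc k)
    have "?I +>\<^bsub>laurent_subring e\<^esub> of_nat (Suc k) =
      ?I +>\<^bsub>laurent_subring e\<^esub> (of_nat k \<oplus>\<^bsub>laurent_subring e\<^esub> \<one>\<^bsub>laurent_subring e\<^esub>)"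
      by (simp add: laurent_subring_simps add.commute)
    then show ?case
      using Suc ring_hom_add[OF hom nat[of k] I.one_closed] ring_hom_one[OF hom] by simp
  qed
qed

text \<open>Since \<epsilon>^2 = q, evaluation at \<epsilon> sends x^(2dj) to q^(dj). This is why
  the index of the cyclotomic polynomial is 2l while the orbit lengths involve l.\<close>

lemma coeff_ring_geometric_sum_eq_zero:
  assumes "0 < l" "l = d * e" "d < l" "\<epsilon>\<^sup>2 = of_nat q"
  shows "[(\<Sum>j<e. q ^ (d * j))] \<cdot>\<^bsub>coeff_ring l \<epsilon>\<^esub> \<one>\<^bsub>coeff_ring l \<epsilon>\<^esub> = \<zero>\<^bsub>coeff_ring l \<epsilon>\<^esub>"
proof -
  let ?L = "laurent_subring \<epsilon>"
  let ?I = "PIdl\<^bsub>?L\<^esub> (poly (cyclotomic_poly (2 * l)) \<epsilon>)"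
  obtain r where r: "int_coeffs r"
    "(\<Sum>j<e. monom 1 (2 * d * j)) = cyclotomic_poly (2 * l) * r"
    using assms cyclotomic_poly_dvd_power_sum by metis
  have "of_nat (\<Sum>j<e. q ^ (d * j)) = poly (\<Sum>j<e. monom 1 (2 * d * j)) \<epsilon>"
    by (simp add: poly_sum poly_monom power_mult assms(4))
  also have "\<dots> = poly r \<epsilon> \<otimes>\<^bsub>?L\<^esub> poly (cyclotomic_poly (2 * l)) \<epsilon>"
    unfolding r(2) by (simp add: laurent_subring_simps mult.commute)
  also have "\<dots> \<in> ?I"
    using poly_in_laurent_subring[OF r(1)] unfolding cgenideal_def by blast
  finally have "?I +>\<^bsub>?L\<^esub> of_nat (\<Sum>j<e. q ^ (d * j)) = ?I"
    using ring.a_rcos_zero[OF _ ideal_cyclotomic[OF assms(1)]] cring_laurent_subring[of \<epsilon>]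
    by (simp add: cring_def)
  then show ?thesis
    unfolding coeff_ring_nat[OF assms(1)] by (simp add: coeff_ring_def FactRing_def)
qed

text \<open>This m is the characteristic. One common modulus is wanted because the orbits occurring
  in a single convolution can have different lengths.\<close>

lemma (in ring) nat_annihilators_principal:
  obtains m :: nat where "[m] \<cdot> \<one> = \<zero>" "\<And>k::nat. [k] \<cdot> \<one> = \<zero> \<Longrightarrow> m dvd k"
proof (cases "\<exists>k::nat. 0 < k \<and> [k] \<cdot> \<one> = \<zero>")
  case False
  show ?thesis
    \<comment> \<open>In characteristic zero m = 0 works: the only k with vanishing multiple is 0,
      and 0 divides it.\<close>
    by (rule that[of 0]) (use False in auto)
next
  case True
  define m where "m = (LEAST k::nat. 0 < k \<and> [k] \<cdot> \<one> = \<zero>)"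
  have m: "0 < m \<and> [m] \<cdot> \<one> = \<zero>"
    unfolding m_def by (rule LeastI_ex) (rule True)
  show ?thesis
  proof (rule that)
    show "[m] \<cdot> \<one> = \<zero>" using m by simp
    fix k :: nat assume k: "[k] \<cdot> \<one> = \<zero>"
    have "[k] \<cdot> \<one> = [(m * (k div m))] \<cdot> \<one> \<oplus> [(k mod m)] \<cdot> \<one>"
      by (simp add: add.nat_pow_mult)
    also have "[(m * (k div m))] \<cdot> \<one> = \<zero>"
      using m by (simp flip: add.nat_pow_pow)
    finally have "[(k mod m)] \<cdot> \<one> = \<zero>" using k by simp
    then have "\<not> 0 < k mod m"
      using not_less_Least[of "k mod m" "\<lambda>k::nat. 0 < k \<and> [k] \<cdot> \<one> = \<zero>", folded m_def] m
        mod_less_divisor[of m k] by metis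
    then show "m dvd k" by auto
  qed
qed

section \<open>Invariant functions on pairs of flags\<close>

lemma restrict_pair_eqI:
  "(\<And>F G. \<lbrakk>F \<in> Y; G \<in> Y\<rbrakk> \<Longrightarrow> f (F, G) = g (F, G)) \<Longrightarrow> restrict f (Y \<times> Y) = restrict g (Y \<times> Y)"
  by (auto simp: restrict_def)

lemma finite_flags:
  assumes "finite (UNIV :: 'v::ab_group_add set)"
  shows "finite (flags (scale :: 'k::field \<Rightarrow> 'v \<Rightarrow> 'v) n)"
proof (rule finite_subset)
  show "flags scale n \<subseteq> {F. set F \<subseteq> UNIV \<and> length F = Suc n}"
    by (auto simp: flags_def)
  show "finite {F. set F \<subseteq> (UNIV :: 'v set set) \<and> length F = Suc n}"
    using assms by (intro finite_lists_length_eq) (simp add: Finite_Set.finite_set)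
qed

lemma GL_image_flag:
  assumes "vector_space scale" "g \<in> GL scale" "F \<in> flags scale n"
  shows "map (image g) F \<in> flags scale n"
proof -
  interpret V: vector_space scale by fact
  have g: "Vector_Spaces.linear scale scale g" and "surj g"
    using assms(2) by (auto simp: GL_def bij_is_surj)
  interpret g: Vector_Spaces.linear scale scale g by (rule g)
  show ?thesis
    using assms(3) \<open>surj g\<close> by (auto simp: flags_def g.zero intro!: g.subspace_image image_mono)
qed

lemma GL_inj_map_image:
  assumes "g \<in> GL scale" shows "inj (map (image g))"
proof -
  have "inj g" using assms by (simp add: GL_def bij_is_inj)
  then have "inj (image g)" by (intro injI) (simp add: inj_image_eq_iff)
  then show ?thesis by (rule inj_mapI)
qed

lemma GL_bij_betw_flags:
  assumes "vector_space scale" "finite (UNIV :: 'v set)" "g \<in> GL scale"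
  shows "bij_betw (map (image g)) (flags scale n) (flags (scale :: 'k::field \<Rightarrow> 'v::ab_group_add \<Rightarrow> 'v) n)"
proof -
  have inj: "inj_on (map (image g)) (flags scale n)"
    using GL_inj_map_image[OF assms(3)] by (rule inj_on_subset) simp
  then show ?thesis
    using endo_inj_surj[OF finite_flags[OF assms(2)] _ inj] GL_image_flag[OF assms(1,3)]
    by (auto simp: bij_betw_def)
qed

lemma schur_ring_simps:
  fixes scale n
  defines "Y \<equiv> flags scale n"
  shows "f \<in> carrier (schur_ring scale n) \<longleftrightarrow> f \<in> extensional (Y \<times> Y) \<and>
      (\<forall>g\<in>GL scale. \<forall>F\<in>Y. \<forall>F'\<in>Y. f (map (image g) F, map (image g) F') = f (F, F'))"
    "f \<otimes>\<^bsub>schur_ring scale n\<^esub> h = (\<lambda>(F, F'')\<in>Y \<times> Y. \<Sum>F'\<in>Y. f (F, F') * h (F', F''))"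
    "\<one>\<^bsub>schur_ring scale n\<^esub> = (\<lambda>(F, F')\<in>Y \<times> Y. if F = F' then 1 else 0)"
    "\<zero>\<^bsub>schur_ring scale n\<^esub> = (\<lambda>p\<in>Y \<times> Y. 0)"
    "f \<oplus>\<^bsub>schur_ring scale n\<^esub> h = (\<lambda>p\<in>Y \<times> Y. f p + h p)"
  by (auto simp: schur_ring_def Let_def Y_def PiE_def)

lemma ring_schur_ring:
  fixes scale :: "'k::field \<Rightarrow> 'v::ab_group_add \<Rightarrow> 'v"
  assumes "vector_space scale" "finite (UNIV :: 'v set)"
  shows "ring (schur_ring scale n)"
proof -
  let ?Y = "flags scale n" and ?S = "schur_ring scale n"
  note im = GL_image_flag[OF assms(1)]
  have fin: "finite ?Y" using assms(2) by (rule finite_flags)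
  \<comment> \<open>Writing an element as its own restriction allows the unit laws to be checked
    pointwise by \<open>restrict_pair_eqI\<close>.\<close>
  have ext: "f = restrict f (?Y \<times> ?Y)" if "f \<in> carrier ?S" for f
    using that by (simp add: schur_ring_simps extensional_restrict)
  have abel: "abelian_group ?S"
  proof (rule abelian_groupI)
    fix f assume f: "f \<in> carrier ?S"
    show "\<exists>h\<in>carrier ?S. h \<oplus>\<^bsub>?S\<^esub> f = \<zero>\<^bsub>?S\<^esub>"
      by (rule bexI[of _ "\<lambda>p\<in>?Y \<times> ?Y. - f p"])
         (use f im in \<open>auto simp: schur_ring_simps intro!: restrict_pair_eqI\<close>)
    show "\<zero>\<^bsub>?S\<^esub> \<oplus>\<^bsub>?S\<^esub> f = f"
      by (subst (2) ext[OF f]) (auto simp: schur_ring_simps intro!: restrict_pair_eqI)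
  qed (use im in \<open>auto simp: schur_ring_simps intro!: restrict_pair_eqI\<close>)
  have "Group.monoid ?S"
  proof (rule monoidI)
    fix f h assume f: "f \<in> carrier ?S" and h: "h \<in> carrier ?S"
    have "(\<Sum>F'\<in>?Y. f (map (image g) F, F') * h (F', map (image g) F'')) =
        (\<Sum>F'\<in>?Y. f (F, F') * h (F', F''))"
      if "g \<in> GL scale" "F \<in> ?Y" "F'' \<in> ?Y" for g F F''
    proof -
      \<comment> \<open>Substituting the image of F' under g for F' reduces invariance of the
        convolution to that of its factors.\<close>
      have "(\<Sum>F'\<in>?Y. f (map (image g) F, F') * h (F', map (image g) F'')) =
        (\<Sum>F'\<in>?Y. f (map (image g) F, map (image g) F') * h (map (image g) F', map (image g) F''))"
        using GL_bij_betw_flags[OF assms that(1)] by (rule sum.reindex_bij_betw[symmetric])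
      also have "\<dots> = (\<Sum>F'\<in>?Y. f (F, F') * h (F', F''))"
        using f h that by (intro sum.cong) (auto simp: schur_ring_simps)
      finally show ?thesis .
    qed
    then show "f \<otimes>\<^bsub>?S\<^esub> h \<in> carrier ?S"
      using im by (auto simp: schur_ring_simps)
    fix k assume k: "k \<in> carrier ?S"
    show "f \<otimes>\<^bsub>?S\<^esub> h \<otimes>\<^bsub>?S\<^esub> k = f \<otimes>\<^bsub>?S\<^esub> (h \<otimes>\<^bsub>?S\<^esub> k)"
      unfolding schur_ring_simps
    proof (rule restrict_pair_eqI, simp)
      fix F G assume FG: "F \<in> ?Y" "G \<in> ?Y"
      have "(\<Sum>F'\<in>?Y. (\<Sum>F''\<in>?Y. f (F, F'') * h (F'', F')) * k (F', G)) =
        (\<Sum>F'\<in>?Y. \<Sum>F''\<in>?Y. f (F, F'') * (h (F'', F') * k (F', G)))"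
        by (simp add: sum_distrib_right mult.assoc)
      also have "\<dots> = (\<Sum>F'\<in>?Y. f (F, F') * (\<Sum>F''\<in>?Y. h (F', F'') * k (F'', G)))"
        by (subst sum.swap) (simp add: sum_distrib_left)
      finally show "(\<Sum>F'\<in>?Y. (\<Sum>F''\<in>?Y. f (F, F'') * h (F'', F')) * k (F', G)) =
        (\<Sum>F'\<in>?Y. f (F, F') * (\<Sum>F''\<in>?Y. h (F', F'') * k (F'', G)))" .
    qed
  next
    show "\<one>\<^bsub>?S\<^esub> \<in> carrier ?S"
    proof -
      have "map (image g) F = map (image g) F' \<longleftrightarrow> F = F'" if "g \<in> GL scale" for g F F'
        using GL_inj_map_image[OF that] by (rule inj_eq)
      then show ?thesis using im by (auto simp: schur_ring_simps)
    qed
    fix f assume f: "f \<in> carrier ?S"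
    have delta: "(\<Sum>F'\<in>?Y. (if F = F' then 1 else 0) * f (F', G)) = f (F, G)"
      "(\<Sum>F'\<in>?Y. f (G, F') * (if F' = F then 1 else 0)) = f (G, F)" if "F \<in> ?Y" for F G
      using that fin by (simp_all add: if_distrib[of "\<lambda>x. x * _"] if_distrib[of "\<lambda>x. _ * x"]
          sum.delta sum.delta' cong: if_cong)
    show "\<one>\<^bsub>?S\<^esub> \<otimes>\<^bsub>?S\<^esub> f = f"
      by (subst (2) ext[OF f]) (auto simp: schur_ring_simps delta intro!: restrict_pair_eqI)
    show "f \<otimes>\<^bsub>?S\<^esub> \<one>\<^bsub>?S\<^esub> = f"
      by (subst (2) ext[OF f]) (auto simp: schur_ring_simps delta intro!: restrict_pair_eqI)
  qed
  with abel show ?thesis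
    by (rule ringI)
      (auto simp: schur_ring_simps sum.distrib distrib_left distrib_right intro!: restrict_pair_eqI)
qed

lemma schur_ring_add_pow:
  fixes k :: nat
  shows "[k] \<cdot>\<^bsub>schur_ring scale n\<^esub> f = (\<lambda>p\<in>flags scale n \<times> flags scale n. int k * f p)"
proof (induction k)
  case 0
  show ?case by (simp add: add_pow_def nat_pow_def schur_ring_simps)
next
  case (Suc k)
  have "[Suc k] \<cdot>\<^bsub>schur_ring scale n\<^esub> f = [k] \<cdot>\<^bsub>schur_ring scale n\<^esub> f \<oplus>\<^bsub>schur_ring scale n\<^esub> f"
    by (simp add: add_pow_def nat_pow_def)
  then show ?case
    by (auto simp: Suc schur_ring_simps distrib_right intro!: restrict_pair_eqI)
qed

section \<open>Counting vectors over a finite field, and divisibility of numbers q^d - 1\<close>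

lemma (in vector_space) card_span_independent:
  assumes "finite B" "independent B" "finite (UNIV :: 'a set)"
  shows "finite (span B) \<and> card (span B) = CARD('a) ^ card B"
  using assms(1,2)
proof (induction B rule: finite_induct)
  case (insert b B)
  then have b: "b \<notin> span B" and IH: "finite (span B)" "card (span B) = CARD('a) ^ card B"
    by (auto simp: independent_insert)
  let ?f = "\<lambda>(k, x). scale k b + x"
  \<comment> \<open>Unique decomposition k b + x multiplies the count by the number of scalars.
    Finiteness of the span is carried along, as the whole space is not assumed finite.\<close>
  have bij: "bij_betw ?f (UNIV \<times> span B) (span (insert b B))"
    unfolding bij_betw_def
  proof
    show "inj_on ?f (UNIV \<times> span B)"
    proof (rule inj_onI; clarify)
      fix k k' x x' assume x: "x \<in> span B" "x' \<in> span B" and eq: "scale k b + x = scale k' b + x'"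
      have diff: "scale (k - k') b = x' - x"
        using eq by (simp add: scale_left_diff_distrib algebra_simps)
      have "k = k'"
      proof (rule ccontr)
        assume ne: "k \<noteq> k'"
        have "scale (inverse (k - k')) (x' - x) \<in> span B"
          using x by (intro span_scale span_diff)
        then show False
          using b ne by (simp flip: diff)
      qed
      then show "k = k' \<and> x = x'" using eq by simp
    qed
    show "?f ` (UNIV \<times> span B) = span (insert b B)"
    proof (intro equalityI subsetI)
      fix y assume "y \<in> span (insert b B)"
      then obtain k where "y - scale k b \<in> span B" by (auto simp: span_insert)
      then show "y \<in> ?f ` (UNIV \<times> span B)"
        by (intro image_eqI[of _ _ "(k, y - scale k b)"]) auto
    next
      fix y assume "y \<in> ?f ` (UNIV \<times> span B)"
      then obtain k x where "y = scale k b + x" "x \<in> span B" by auto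
      then show "y \<in> span (insert b B)"
        unfolding span_insert by (auto intro!: exI[of _ k])
    qed
  qed
  then show ?case
    using IH insert.hyps assms(3) bij_betw_finite[OF bij] bij_betw_same_card[OF bij]
    by (simp add: card_cartesian_product)
qed simp

lemma (in vector_space) card_subspace:
  assumes "subspace S" "finite S" "finite (UNIV :: 'a set)"
  obtains d where "card S = CARD('a) ^ d"
proof -
  obtain B where B: "B \<subseteq> S" "independent B" "span B = S"
    using assms(1) by (metis basis_exists span_subspace)
  then show ?thesis
    using that card_span_independent[of B] finite_subset[OF B(1) assms(2)] assms(3) by simp
qed

text \<open>An infinite basis would have \<open>card\<close> equal to 0, so positive dimension
  forces a finite basis and hence finitely many vectors.\<close>

lemma (in vector_space) finite_if_dim_pos:
  assumes "0 < dim UNIV" "finite (UNIV :: 'a set)"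
  shows "finite (UNIV :: 'b set)"
proof -
  obtain B where B: "independent B" "UNIV \<subseteq> span B" "card B = dim UNIV"
    using basis_exists[of UNIV] by metis
  then have "finite B" using assms(1) by (metis card.infinite less_numeral_extra(3))
  then show ?thesis
    using card_span_independent[OF _ B(1) assms(2)] B(2) by (simp add: top.extremum_unique)
qed

text \<open>Euclidean descent on the exponent: q^l - 1 is congruent to q^(l-d) - 1 modulo q^d -
  1.\<close>

lemma dvd_of_power_minus_one_dvd:
  fixes q d l :: nat
  assumes "1 < q" "0 < d" "(q ^ d - 1) dvd (q ^ l - 1)"
  shows "d dvd l"
  using assms(3)
proof (induction l rule: less_induct)
  case (less l)
  show ?case
  proof (cases "l < d")
    case True
    \<comment> \<open>A number below its divisor must be zero, which leaves l = 0.\<close>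
    have "q ^ l - 1 < q ^ d - 1"
      using assms(1) power_strict_increasing[OF True assms(1)] one_le_power[of q l]
      by linarith
    then have "q ^ l - 1 = 0"
      using less.prems nat_dvd_not_less by blast
    then show ?thesis
      using assms(1) by (metis One_nat_def diff_is_0_eq dvd_0_right leD one_less_power bot_nat_0.not_eq_extremum)
  next
    case False
    have "q ^ l - 1 = q ^ (l - d) * (q ^ d - 1) + (q ^ (l - d) - 1)"
      using False assms(1) one_le_power[of q "l - d"] one_le_power[of q d]
      by (simp add: diff_mult_distrib2 flip: power_add)
    then have "(q ^ d - 1) dvd (q ^ (l - d) - 1)"
      using less.prems by (metis dvd_add_right_iff dvd_triv_right)
    then have "d dvd l - d"
      using less.IH[of "l - d"] False assms(2) by simp
    then show ?thesis
      using False by (metis dvd_diff_nat dvd_refl le_add_diff_inverse dvd_add not_less)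
  qed
qed

lemma geometric_quotient_nat:
  fixes q d e N :: nat
  assumes "1 < q" "0 < d" "(q ^ d - 1) * N = q ^ (d * e) - 1"
  shows "N = (\<Sum>j<e. q ^ (d * j))"
proof -
  have gt: "1 < q ^ d" using assms(1,2) by (rule one_less_power)
  have "int ((q ^ d - 1) * (\<Sum>j<e. q ^ (d * j))) = int (q ^ (d * e) - 1)"
    using power_diff_1_eq[of "int q ^ d" e] gt assms(1)
    by (simp add: of_nat_diff power_mult)
  then have "(q ^ d - 1) * (\<Sum>j<e. q ^ (d * j)) = (q ^ d - 1) * N"
    unfolding assms(3) by (simp only: of_nat_eq_iff)
  then show ?thesis using gt by simp
qed

section \<open>Actions of the multiplicative group of a finite field\<close>

locale units_action =
  fixes act :: "'K::{field,finite} \<Rightarrow> 'x \<Rightarrow> 'x" and S :: "'x set"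
  assumes act_closed: "\<lbrakk>c \<noteq> 0; x \<in> S\<rbrakk> \<Longrightarrow> act c x \<in> S"
    and act_one: "x \<in> S \<Longrightarrow> act 1 x = x"
    and act_mult: "\<lbrakk>c \<noteq> 0; d \<noteq> 0; x \<in> S\<rbrakk> \<Longrightarrow> act c (act d x) = act (c * d) x"
begin

definition "orb x = (\<lambda>c. act c x) ` (UNIV - {0})"
definition "stab x = {c. c \<noteq> 0 \<and> act c x = x}"

lemma orb_eq:
  assumes "x \<in> S" "y \<in> orb x" shows "orb y = orb x"
proof -
  from assms(2) obtain c where c: "c \<noteq> 0" "y = act c x" by (auto simp: orb_def)
  show ?thesis
  proof (intro equalityI subsetI)
    fix z assume "z \<in> orb y"
    then obtain d where "d \<noteq> 0" "z = act (d * c) x"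
      using c assms(1) by (auto simp: orb_def act_mult)
    then show "z \<in> orb x" using c by (auto simp: orb_def)
  next
    fix z assume "z \<in> orb x"
    then obtain d where d: "d \<noteq> 0" "z = act d x"
      by (auto simp: orb_def)
    then have "z = act (d * inverse c * c) x"
      using c by (simp add: mult.assoc)
    also have "\<dots> = act (d * inverse c) y"
      using c d assms(1) by (subst act_mult[symmetric]) auto
    finally have "z = act (d * inverse c) y" .
    then show "z \<in> orb y" using c d by (auto simp: orb_def)
  qed
qed

lemma orb_self: "x \<in> S \<Longrightarrow> x \<in> orb x"
  unfolding orb_def by (rule image_eqI[of _ _ 1]) (simp_all add: act_one)

lemma orb_subset: "x \<in> S \<Longrightarrow> orb x \<subseteq> S"
  unfolding orb_def using act_closed by blast

text \<open>Orbit-stabilizer: the units are fibred over the orbit, and the fibre over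
  \<open>act d x\<close> is the coset d times the stabilizer.\<close>

lemma card_orb_stab:
  assumes "x \<in> S" shows "card (stab x) * card (orb x) = CARD('K) - 1"
proof -
  have "CARD('K) - 1 = card (UNIV - {0 :: 'K})" by simp
  also have "\<dots> = (\<Sum>y\<in>orb x. card {c \<in> UNIV - {0}. act c x = y})"
    using sum.image_gen[of "UNIV - {0}" "\<lambda>_. 1::nat" "\<lambda>c. act c x"] by (simp add: orb_def)
  also have "\<dots> = (\<Sum>y\<in>orb x. card (stab x))"
  proof (rule sum.cong)
    fix y assume "y \<in> orb x"
    then obtain d where d: "d \<noteq> 0" "y = act d x" by (auto simp: orb_def)
    have "{c \<in> UNIV - {0}. act c x = y} = (\<lambda>c. d * c) ` stab x"
    proof (intro equalityI subsetI)
      fix c assume c: "c \<in> {c \<in> UNIV - {0}. act c x = y}"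
      then have "act (inverse d * c) x = act (inverse d) (act d x)"
        using d assms by (simp add: act_mult[symmetric])
      then have "inverse d * c \<in> stab x"
        using c d assms by (simp add: stab_def act_mult act_one)
      then show "c \<in> (\<lambda>c. d * c) ` stab x"
        using d by (intro image_eqI[of _ _ "inverse d * c"]) auto
    next
      fix c assume "c \<in> (\<lambda>c. d * c) ` stab x"
      then obtain e where e: "c = d * e" "e \<noteq> 0" "act e x = x" by (auto simp: stab_def)
      then show "c \<in> {c \<in> UNIV - {0}. act c x = y}"
        using d assms by (simp add: act_mult[symmetric])
    qed
    moreover have "inj_on (\<lambda>c. d * c) (stab x)" using d by (simp add: inj_on_def)
    ultimately show "card {c \<in> UNIV - {0}. act c x = y} = card (stab x)"
      by (simp add: card_image)
  qed simp
  also have "\<dots> = card (stab x) * card (orb x)" by simp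
  finally show ?thesis ..
qed

text \<open>The fibres of \<open>orb\<close> are the orbits themselves, and each contributes its
  length times a single value of h.\<close>

lemma dvd_sum_orbits:
  fixes h :: "'x \<Rightarrow> int"
  assumes "finite S" "\<And>x. x \<in> S \<Longrightarrow> m dvd card (orb x)"
    "\<And>c x. \<lbrakk>c \<noteq> 0; x \<in> S\<rbrakk> \<Longrightarrow> h (act c x) = h x"
  shows "int m dvd sum h S"
proof -
  have "sum h S = (\<Sum>U\<in>orb ` S. sum h {x \<in> S. orb x = U})"
    by (rule sum.image_gen[OF assms(1)])
  also have "int m dvd \<dots>"
  proof (rule dvd_sum, clarify)
    fix x assume x: "x \<in> S"
    have "{y \<in> S. orb y = orb x} = orb x"
      using x orb_eq orb_self orb_subset by blast
    moreover have "sum h (orb x) = int (card (orb x)) * h x"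
    proof -
      have "h y = h x" if "y \<in> orb x" for y
        using that x assms(3) by (auto simp: orb_def)
      then show ?thesis by simp
    qed
    ultimately show "int m dvd sum h {y \<in> S. orb y = orb x}"
      using assms(2)[OF x] by simp
  qed
  finally show ?thesis .
qed

end

section \<open>Restriction of scalars\<close>

text \<open>The two fields are separate types, so the inclusion is a ring homomorphism
  \<open>emb\<close>, and W is the same group of vectors with scalars acting through
  \<open>emb\<close>.\<close>

locale restriction_of_scalars = V: vector_space scale
  for scale :: "'K::{field,finite} \<Rightarrow> 'v::ab_group_add \<Rightarrow> 'v" +
  fixes emb :: "'k::{field,finite} \<Rightarrow> 'K" and q l n :: nat
  assumes emb: "emb \<in> ring_hom ring_of_type_algebra ring_of_type_algebra"
    and card_k: "CARD('k) = q" and card_K: "CARD('K) = q ^ l"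
    and finite_vectors: "finite (UNIV :: 'v set)"
begin

abbreviation "scale_W \<equiv> \<lambda>c. scale (emb c)"
abbreviation "Y_V \<equiv> flags scale n"
abbreviation "Y_W \<equiv> flags scale_W n"
abbreviation "S_V \<equiv> schur_ring scale n"
abbreviation "S_W \<equiv> schur_ring scale_W n"
abbreviation "act \<equiv> \<lambda>c. map (image (scale c))"

lemma emb_simps: "emb (a + b) = emb a + emb b" "emb (a * b) = emb a * emb b" "emb 1 = 1"
  using ring_hom_add[OF emb, of a b] ring_hom_mult[OF emb, of a b] ring_hom_one[OF emb]
  by (simp_all add: ring_of_type_algebra_simps)

lemma vector_space_W: "vector_space scale_W"
  by unfold_locales
    (simp_all add: emb_simps V.scale_right_distrib V.scale_left_distrib)

sublocale W: vector_space scale_W by (rule vector_space_W)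

text \<open>The large field as a vector space over the small one; its finite subspaces have q-power
  cardinality.\<close>

sublocale k_mult: vector_space "\<lambda>a c. emb a * c"
  by unfold_locales (simp_all add: emb_simps algebra_simps)

lemma q_gt_1: "1 < q"
proof -
  have "card {0, 1 :: 'k} \<le> CARD('k)" by (intro card_mono) auto
  then show ?thesis by (simp add: card_k)
qed

lemma subspace_W: "V.subspace S \<Longrightarrow> W.subspace S"
  by (auto simp: V.subspace_def W.subspace_def)

lemma flags_V_subset_W: "Y_V \<subseteq> Y_W"
  by (auto simp: flags_def subspace_W)

lemma GL_V_subset_W: "GL scale \<subseteq> GL scale_W"
  by (auto simp: GL_def Vector_Spaces.linear_iff vector_space_W)

text \<open>Commutativity of the large field makes its units linear over the small field, so
  functions in \<open>S_W\<close> are invariant under their diagonal action.\<close>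

lemma scale_in_GL_W: "c \<noteq> 0 \<Longrightarrow> scale c \<in> GL scale_W"
  unfolding GL_def
  by (auto simp: Vector_Spaces.linear_iff vector_space_W V.scale_right_distrib mult.commute
      intro!: o_bij[of "scale (inverse c)"])

lemma finite_Y_W: "finite Y_W"
  using finite_vectors by (rule finite_flags)

lemma act_flag_W: "\<lbrakk>c \<noteq> 0; U \<in> Y_W\<rbrakk> \<Longrightarrow> act c U \<in> Y_W"
  using GL_image_flag[OF vector_space_W scale_in_GL_W] .

lemma act_flag_V:
  assumes "c \<noteq> 0" "U \<in> Y_V" shows "act c U = U"
proof (rule nth_equalityI)
  fix i assume "i < length (act c U)"
  then have i: "V.subspace (U ! i)" "i < length U"
    using assms(2) by (auto simp: flags_def)
  have "x \<in> scale c ` (U ! i)" if "x \<in> U ! i" for x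
    using V.subspace_scale[OF i(1) that, of "inverse c"] assms(1)
    by (intro image_eqI[of _ _ "scale (inverse c) x"]) auto
  then show "act c U ! i = U ! i"
    using i V.subspace_scale by auto
qed simp

lemma act_1: "act 1 U = U"
  by (simp add: map_idI)

lemma act_act: "act c (act d U) = act (c * d) U"
  by (simp add: image_image)

sublocale units_action act Y_W
  by unfold_locales (simp_all only: act_flag_W act_1 act_act not_False_eq_True)

text \<open>If a unit moved U into \<open>Y_V\<close>, its inverse would fix the result, yet it also
  carries it back to U; so U would lie in \<open>Y_V\<close>.\<close>

sublocale nonfixed: units_action act "Y_W - Y_V"
proof
  fix c :: 'K and U assume c: "c \<noteq> 0" and U: "U \<in> Y_W - Y_V"
  have "U = act (inverse c) (act c U)"
    by (simp only: act_act left_inverse[OF c] act_1)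
  then have "act c U \<notin> Y_V"
    using U c act_flag_V[of "inverse c" "act c U"] by (metis DiffD2 nonzero_imp_inverse_nonzero)
  then show "act c U \<in> Y_W - Y_V" using act_flag_W c U by blast
qed (simp_all only: act_1 act_act)

text \<open>Asking for inclusion and not equality admits 0 and makes the set closed under addition,
  so it can be counted as a subspace over the small field.\<close>

definition "multiplier U = {c. \<forall>i\<le>n. \<forall>x\<in>U ! i. scale c x \<in> U ! i}"

text \<open>A nonzero scalar acts injectively, and an injective self-map of a finite subspace is
  onto, so inclusion is already equality.\<close>

lemma multiplier_eq_stab:
  assumes "U \<in> Y_W" shows "multiplier U = insert 0 (stab U)"
proof (intro equalityI subsetI)
  have U: "length U = Suc n" "\<And>i. i \<le> n \<Longrightarrow> W.subspace (U ! i)"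
    using assms by (auto simp: flags_def)
  {
    fix c assume c: "c \<in> multiplier U"
    have "act c U = U" if "c \<noteq> 0"
    proof (rule nth_equalityI)
      fix i assume "i < length (act c U)"
      then have i: "i \<le> n" using U by simp
      have "scale c ` (U ! i) = U ! i"
        by (rule endo_inj_surj)
          (use i c that in \<open>auto simp: multiplier_def inj_on_def intro: finite_subset[OF _ finite_vectors]\<close>)
      then show "act c U ! i = U ! i" using i U by simp
    qed simp
    then show "c \<in> insert 0 (stab U)" by (auto simp: stab_def)
  next
    fix c assume "c \<in> insert 0 (stab U)"
    then consider "c = 0" | "act c U = U" by (auto simp: stab_def)
    then show "c \<in> multiplier U"
    proof cases
      case 1
      then show ?thesis using U W.subspace_0 by (simp add: multiplier_def)
    next
      case 2
      then have "scale c ` (U ! i) = U ! i" if "i \<le> n" for i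
        using U that nth_map[of i U "image (scale c)"] by simp
      then show ?thesis by (auto simp: multiplier_def)
    qed
  }
qed

lemma subspace_multiplier:
  assumes "U \<in> Y_W" shows "k_mult.subspace (multiplier U)"
proof -
  have "W.subspace (U ! i)" if "i \<le> n" for i
    using assms that by (auto simp: flags_def)
  then show ?thesis
    using W.subspace_0 W.subspace_add W.subspace_scale
    by (auto simp: k_mult.subspace_def multiplier_def V.scale_left_distrib simp flip: V.scale_scale)
qed

lemma multiplier_UNIV:
  assumes "U \<in> Y_W" "multiplier U = UNIV" shows "U \<in> Y_V"
  using assms by (auto simp: flags_def multiplier_def W.subspace_def V.subspace_def set_eq_iff)

text \<open>The multiplier of \<open>U\<close> is an intermediate field of order \<open>q ^ d\<close>, and a proper one if \<open>U\<close> is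
  not a flag over the large field.\<close>

lemma card_orb_nonfixed:
  assumes "U \<in> Y_W - Y_V"
  obtains d e where "l = d * e" "d < l" "card (orb U) = (\<Sum>j<e. q ^ (d * j))"
proof -
  have U: "U \<in> Y_W" using assms by simp
  obtain d where d: "card (multiplier U) = q ^ d"
    using k_mult.card_subspace[OF subspace_multiplier[OF U]] by (auto simp: card_k)
  have stab: "card (stab U) = q ^ d - 1"
    using d by (simp add: multiplier_eq_stab[OF U] stab_def)
  \<comment> \<open>For d = 0 the stabilizer would be empty, but it contains 1.\<close>
  have "1 \<in> stab U" unfolding stab_def using act_1 by simp
  then have "card (stab U) \<noteq> 0" by auto
  then have "0 < d" using stab by (cases d) auto
  have "multiplier U \<noteq> UNIV" using multiplier_UNIV U assms by blast
  then have "q ^ d < q ^ l"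
    unfolding d[symmetric] card_K[symmetric] by (intro psubset_card_mono) auto
  then have "d < l" using q_gt_1 by simp
  \<comment> \<open>Orbit-stabilizer serves twice: it forces d to divide l, and then it determines
    the orbit length as a geometric sum.\<close>
  have orb: "(q ^ d - 1) * card (orb U) = q ^ l - 1"
    using card_orb_stab[OF U] by (simp add: stab card_K)
  then have "d dvd l"
    using dvd_of_power_minus_one_dvd[OF q_gt_1 \<open>0 < d\<close>] by (metis dvd_triv_left)
  then obtain e where e: "l = d * e" by blast
  show ?thesis
    using that[OF e \<open>d < l\<close>] geometric_quotient_nat[OF q_gt_1 \<open>0 < d\<close> orb[unfolded e]] .
qed

text \<open>The outer flags F and F'' are fixed by all units, so diagonal invariance of f and h
  makes each summand constant along the orbit of the middle flag.\<close>

lemma dvd_sum_nonfixed: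
  assumes m: "\<And>d e. \<lbrakk>l = d * e; d < l\<rbrakk> \<Longrightarrow> m dvd (\<Sum>j<e. q ^ (d * j))"
    and f: "f \<in> carrier S_W" and h: "h \<in> carrier S_W" and F: "F \<in> Y_V" "F'' \<in> Y_V"
  shows "int m dvd (\<Sum>F'\<in>Y_W - Y_V. f (F, F') * h (F', F''))"
proof (rule nonfixed.dvd_sum_orbits)
  show "m dvd card (nonfixed.orb U)" if "U \<in> Y_W - Y_V" for U
    \<comment> \<open>Both interpretations define the same orbits, since \<open>orb\<close> depends
      only on the action and not on the ambient set.\<close>
    using card_orb_nonfixed[OF that] m by (metis nonfixed.orb_def orb_def)
  fix c :: 'K and U assume c: "c \<noteq> 0" and U: "U \<in> Y_W - Y_V"
  have "f (act c F, act c U) = f (F, U)" "h (act c U, act c F'') = h (U, F'')"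
    using f h scale_in_GL_W[OF c] U F flags_V_subset_W by (auto simp: schur_ring_simps)
  then show "f (F, act c U) * h (act c U, F'') = f (F, U) * h (U, F'')"
    by (simp add: act_flag_V[OF c] F)
qed (use finite_Y_W in auto)

section \<open>Restriction of functions respects convolution modulo m\<close>

abbreviation "\<rho> \<equiv> flag_restrict scale n"

lemma \<rho>_closed: "f \<in> carrier S_W \<Longrightarrow> \<rho> f \<in> carrier S_V"
  using GL_image_flag[OF V.vector_space_axioms] flags_V_subset_W GL_V_subset_W
  by (auto simp: flag_restrict_def schur_ring_simps subset_iff)

lemma \<rho>_add: "\<rho> (f \<oplus>\<^bsub>S_W\<^esub> h) = \<rho> f \<oplus>\<^bsub>S_V\<^esub> \<rho> h"
  unfolding flag_restrict_def schur_ring_simps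
  by (rule restrict_pair_eqI) (use flags_V_subset_W in auto)

lemma \<rho>_one: "\<rho> \<one>\<^bsub>S_W\<^esub> = \<one>\<^bsub>S_V\<^esub>"
  unfolding flag_restrict_def schur_ring_simps
  by (rule restrict_pair_eqI) (use flags_V_subset_W in auto)

lemma \<rho>_mult_congruent:
  assumes m: "\<And>d e. \<lbrakk>l = d * e; d < l\<rbrakk> \<Longrightarrow> m dvd (\<Sum>j<e. q ^ (d * j))"
    and f: "f \<in> carrier S_W" and h: "h \<in> carrier S_W"
  obtains s where "s \<in> carrier S_V"
    "\<rho> (f \<otimes>\<^bsub>S_W\<^esub> h) = \<rho> f \<otimes>\<^bsub>S_V\<^esub> \<rho> h \<oplus>\<^bsub>S_V\<^esub> [m] \<cdot>\<^bsub>S_V\<^esub> s"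
proof -
  interpret S_W: ring S_W by (rule ring_schur_ring[OF vector_space_W finite_vectors])
  interpret S_V: ring S_V by (rule ring_schur_ring[OF V.vector_space_axioms finite_vectors])
  define D where "D p = \<rho> (f \<otimes>\<^bsub>S_W\<^esub> h) p - (\<rho> f \<otimes>\<^bsub>S_V\<^esub> \<rho> h) p" for p
  have D: "D (F, F'') = (\<Sum>F'\<in>Y_W - Y_V. f (F, F') * h (F', F''))"
    if "F \<in> Y_V" "F'' \<in> Y_V" for F F''
  proof -
    have "(\<Sum>F'\<in>Y_W. f (F, F') * h (F', F'')) =
      (\<Sum>F'\<in>Y_W - Y_V. f (F, F') * h (F', F'')) + (\<Sum>F'\<in>Y_V. f (F, F') * h (F', F''))"
      by (rule sum.subset_diff[OF flags_V_subset_W finite_Y_W])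
    then show ?thesis
      using that flags_V_subset_W by (auto simp: D_def flag_restrict_def schur_ring_simps)
  qed
  have closed: "\<rho> (f \<otimes>\<^bsub>S_W\<^esub> h) \<in> carrier S_V" "\<rho> f \<otimes>\<^bsub>S_V\<^esub> \<rho> h \<in> carrier S_V"
    using f h by (auto intro: \<rho>_closed)
  show ?thesis
  proof
    \<comment> \<open>The correction is the pointwise quotient of the discrepancy \<open>D\<close>
      by m. Its invariance comes from that of \<open>D\<close>, whatever the remainders; exactness,
      proved below, also covers m = 0, where divisibility forces \<open>D\<close> to vanish.\<close>
    show "restrict (\<lambda>p. D p div int m) (Y_V \<times> Y_V) \<in> carrier S_V"
      using closed GL_image_flag[OF V.vector_space_axioms]
      unfolding schur_ring_simps(1) by (simp add: D_def)
    have "\<rho> (f \<otimes>\<^bsub>S_W\<^esub> h) = restrict (\<rho> (f \<otimes>\<^bsub>S_W\<^esub> h)) (Y_V \<times> Y_V)"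
      by (simp add: flag_restrict_def)
    also have "\<dots> = \<rho> f \<otimes>\<^bsub>S_V\<^esub> \<rho> h \<oplus>\<^bsub>S_V\<^esub> [m] \<cdot>\<^bsub>S_V\<^esub> (\<lambda>p\<in>Y_V \<times> Y_V. D p div int m)"
      unfolding schur_ring_add_pow schur_ring_simps(5)
    proof (rule restrict_pair_eqI)
      fix F F'' assume F: "F \<in> Y_V" "F'' \<in> Y_V"
      have "int m dvd D (F, F'')"
        unfolding D[OF F] by (rule dvd_sum_nonfixed[OF m f h F])
      then have "int m * (D (F, F'') div int m) = D (F, F'')" by simp
      then show "\<rho> (f \<otimes>\<^bsub>S_W\<^esub> h) (F, F'') = (\<rho> f \<otimes>\<^bsub>S_V\<^esub> \<rho> h) (F, F'') +
          (\<lambda>p\<in>Y_V \<times> Y_V. int m * (\<lambda>p\<in>Y_V \<times> Y_V. D p div int m) p) (F, F'')"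
        using F by (simp add: D_def)
    qed
    finally show "\<rho> (f \<otimes>\<^bsub>S_W\<^esub> h) =
      \<rho> f \<otimes>\<^bsub>S_V\<^esub> \<rho> h \<oplus>\<^bsub>S_V\<^esub> [m] \<cdot>\<^bsub>S_V\<^esub> (\<lambda>p\<in>Y_V \<times> Y_V. D p div int m)" .
  qed
qed

end

theorem proposition3p3:
  fixes scale :: "'K::{field,finite} \<Rightarrow> 'v::ab_group_add \<Rightarrow> 'v"
    and emb :: "'k::{field,finite} \<Rightarrow> 'K"
    and l n r q :: nat
    and \<epsilon> :: complex
  assumes "0 < l" and "0 < n" and "0 < r"
    and "primepow q" and "CARD('k) = q" and "CARD('K) = q ^ l"
    and "emb \<in> ring_hom ring_of_type_algebra ring_of_type_algebra"
    and "vector_space scale" and "vector_space.dim scale UNIV = r"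
    and "\<epsilon>\<^sup>2 = of_nat q"
  defines "A \<equiv> coeff_ring l \<epsilon>"
    and "S_W \<equiv> schur_ring (\<lambda>c. scale (emb c)) n"
    and "S_V \<equiv> schur_ring scale n"
  shows "assoc_algebra_hom A (base_change A S_W) (base_change A S_V)
    (base_change_map A S_W S_V (flag_restrict scale n))"
proof -
  have "finite (UNIV :: 'v set)"
    using vector_space.finite_if_dim_pos[OF assms(8)] assms(3,9) by simp
  then interpret restriction_of_scalars scale emb q l n
    using assms by (simp add: restriction_of_scalars_def restriction_of_scalars_axioms_def)
  interpret A: cring A
    unfolding A_def using assms(1) by (rule cring_coeff_ring)
  interpret R_W: ring S_W
    unfolding S_W_def by (rule ring_schur_ring[OF vector_space_W finite_vectors])
  interpret R_V: ring S_V
    unfolding S_V_def by (rule ring_schur_ring[OF V.vector_space_axioms finite_vectors])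
  interpret tensor_map A S_W S_V "flag_restrict scale n"
    by unfold_locales (simp_all add: S_W_def S_V_def \<rho>_closed \<rho>_add)
  \<comment> \<open>With m the characteristic of \<open>A\<close>, vanishing of the geometric sums
    in \<open>A\<close> becomes divisibility by m.\<close>
  obtain m :: nat where m: "[m] \<cdot>\<^bsub>A\<^esub> \<one>\<^bsub>A\<^esub> = \<zero>\<^bsub>A\<^esub>"
    "\<And>k::nat. [k] \<cdot>\<^bsub>A\<^esub> \<one>\<^bsub>A\<^esub> = \<zero>\<^bsub>A\<^esub> \<Longrightarrow> m dvd k"
    using A.nat_annihilators_principal by metis
  have m_dvd: "m dvd (\<Sum>j<e. q ^ (d * j))" if "l = d * e" "d < l" for d e
    using m(2) coeff_ring_geometric_sum_eq_zero[OF assms(1) that assms(10)] by (simp add: A_def)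
  show ?thesis
  proof (rule assoc_algebra_hom_base_change_map)
    show "flag_restrict scale n \<one>\<^bsub>S_W\<^esub> = \<one>\<^bsub>S_V\<^esub>"
      by (simp add: S_W_def S_V_def \<rho>_one)
  next
    fix a f h assume a: "a \<in> carrier A" and f: "f \<in> carrier S_W" and h: "h \<in> carrier S_W"
    obtain s where s: "s \<in> carrier S_V"
      "flag_restrict scale n (f \<otimes>\<^bsub>S_W\<^esub> h) =
        flag_restrict scale n f \<otimes>\<^bsub>S_V\<^esub> flag_restrict scale n h \<oplus>\<^bsub>S_V\<^esub> [m] \<cdot>\<^bsub>S_V\<^esub> s"
      using \<rho>_mult_congruent[OF m_dvd] f h unfolding S_W_def S_V_def by metis
    \<comment> \<open>Killing 1, m kills all of \<open>A\<close>; \<open>K_torsion\<close> then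
      removes the correction term m s under the tensor sign.\<close>
    have "[m] \<cdot>\<^bsub>A\<^esub> a = \<zero>\<^bsub>A\<^esub>"
      using A.add_pow_ldistr[OF A.one_closed a, of m] a m(1) by simp
    with a f h s(1) show "frag_of (a, flag_restrict scale n (f \<otimes>\<^bsub>S_W\<^esub> h)) -
        frag_of (a, flag_restrict scale n f \<otimes>\<^bsub>S_V\<^esub> flag_restrict scale n h) \<in> C.K"
      unfolding s(2) by (intro C.K_torsion) (auto simp: \<phi>_closed)
  qed
qed

end
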